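(* Let $d\ge1$. For any full barcode $D=(D_0,D_1,D_2,\dots)$, the dimensions of $(\mathrm{PH}^{\check{\mathrm C}})^{-1}(D)$ and of $(\mathrm{PH}^{\mathrm{VR}})^{-1}(D)$ are both less than or equal to $nd-n+1$, where $n$ is the number of intervals in $D_0$ (counted with multiplicity, and hence the number of points in any point cloud $P$ in the fiber; the fibers are subsets of $\mathrm{PC}_{n,d}$).
   Context: Fix a field $\mathbb{F}$; $H_i$ denotes homology in degree $i$ with coefficients in $\mathbb{F}$. $\mathrm{PC}_{n,d}=\{(p_1,\dots,p_n)\in\mathbb{R}^{nd}: p_i\in\mathbb{R}^d,\ p_i\ne p_j \text{ for } i\neq j\}$; its elements are called point clouds. Write $[n]=\{1,\dots,n\}$. A barcode is a multiset of nonempty intervals in $\mathbb{R}$; a full barcode is a sequence $D=(D_i)_{i\ge0}$ of barcodes. For a filtration $\mathcal X=\{X_t\}_{t\in\mathbb{R}}$ whose persistence modules $\{H_i(X_t)\}_{t}$ are tame (pointwise finite dimensional with finitely many critical values), the degree-$i$ persistent homology is the unique (finite) multiset $D_i$ of nonempty intervals with $\{H_i(X_t)\}_t\cong\bigoplus_{I\in D_i}\chi_I$, where $\chi_I$ is the interval module of $I$. The persistent homology of $\mathcal X$ is the full barcode $D=(D_i)_{i\ge 0}$. For $P=(p_1,\dots,p_n)\in\mathrm{PC}_{n,d}$: $\mathrm{PH}^{\mathrm{VR}}(P)$ is the persistent homology of the Vietoris–Rips filtration $\mathrm{VR}(P,r)=\{\emptyset\ne\sigma\subseteq[n]:\|p_i-p_j\|\le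 2r\ \forall i,j\in\sigma\}$, $r\in\mathbb{R}$ (empty for $r<0$), and $\mathrm{PH}^{\check{\mathrm C}}(P)$ is the persistent homology of the Čech filtration $\{\bigcup_{i=1}^n B_r(p_i)\}_{r\in\mathbb{R}}$ by unions of closed balls of radius $r$ (empty for $r<0$), equivalently of the simplicial filtration $\{\emptyset\ne\sigma\subseteq[n]:\exists q\in\mathbb{R}^d,\ \|p_i-q\|\le r\ \forall i\in\sigma\}$. The fibers $\{Q\in\mathrm{PC}_{n,d}:\mathrm{PH}(Q)=D\}$ are semialgebraic sets, and dimension means dimension as a semialgebraic set (with $\dim\emptyset=-\infty$). *)

theory Defs
  imports "HOL-Analysis.Analysis" "HOL-Library.Multiset" "HOL-Algebra.Ideal"
begin

section \<open>Persistence modules and barcodes\<close>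

text \<open>A family of vector spaces over \<open>'k\<close> indexed by the reals, given by carriers, operations
  on the carriers, and transition maps \<open>pm_map M s t\<close>, which are relevant for \<open>s \<le> t\<close> only.\<close>

record ('k, 'v) persistence_module =
  pm_space :: "real \<Rightarrow> 'v set"
  pm_add :: "real \<Rightarrow> 'v \<Rightarrow> 'v \<Rightarrow> 'v"
  pm_scale :: "real \<Rightarrow> 'k \<Rightarrow> 'v \<Rightarrow> 'v"
  pm_map :: "real \<Rightarrow> real \<Rightarrow> 'v \<Rightarrow> 'v"

definition pm_isomorphic ::
  "('k, 'v) persistence_module \<Rightarrow> ('k, 'w) persistence_module \<Rightarrow> bool" where
  "pm_isomorphic M N \<longleftrightarrow> (\<exists>\<phi> :: real \<Rightarrow> 'v \<Rightarrow> 'w.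
     (\<forall>t. bij_betw (\<phi> t) (pm_space M t) (pm_space N t)) \<and>
     (\<forall>t. \<forall>x\<in>pm_space M t. \<forall>y\<in>pm_space M t. \<phi> t (pm_add M t x y) = pm_add N t (\<phi> t x) (\<phi> t y)) \<and>
     (\<forall>t. \<forall>a. \<forall>x\<in>pm_space M t. \<phi> t (pm_scale M t a x) = pm_scale N t a (\<phi> t x)) \<and>
     (\<forall>s t. s \<le> t \<longrightarrow> (\<forall>x\<in>pm_space M s. \<phi> t (pm_map M s t x) = pm_map N s t (\<phi> s x))))"

definition interval_module :: "real set \<Rightarrow> ('k :: field, 'k) persistence_module" where
  "interval_module I =
    \<lparr> pm_space = (\<lambda>t. if t \<in> I then UNIV else {0}),
      pm_add = (\<lambda>t x y. x + y),
      pm_scale = (\<lambda>t a x. a * x),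
      pm_map = (\<lambda>s t x. if s \<in> I \<and> t \<in> I then x else 0) \<rparr>"

text \<open>The product of a family; this is the direct sum when the index set is finite, which is
  the only case in which it is used.\<close>

definition pm_direct_sum ::
  "'j set \<Rightarrow> ('j \<Rightarrow> ('k, 'v) persistence_module) \<Rightarrow> ('k, 'j \<Rightarrow> 'v) persistence_module" where
  "pm_direct_sum J M =
    \<lparr> pm_space = (\<lambda>t. \<Pi>\<^sub>E j\<in>J. pm_space (M j) t),
      pm_add = (\<lambda>t f g. \<lambda>j\<in>J. pm_add (M j) t (f j) (g j)),
      pm_scale = (\<lambda>t a f. \<lambda>j\<in>J. pm_scale (M j) t a (f j)),
      pm_map = (\<lambda>s t f. \<lambda>j\<in>J. pm_map (M j) s t (f j)) \<rparr>"

definition barcode :: "real set multiset \<Rightarrow> bool" where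
  "barcode B \<longleftrightarrow> (\<forall>I \<in># B. is_interval I \<and> I \<noteq> {})"

definition full_barcode :: "(nat \<Rightarrow> real set multiset) \<Rightarrow> bool" where
  "full_barcode D \<longleftrightarrow> (\<forall>i. barcode (D i))"

text \<open>The copies of \<open>I\<close> in the multiset are indexed by the pairs \<open>(I, m)\<close> with
  \<open>m < count B I\<close>.\<close>

definition barcode_module ::
  "real set multiset \<Rightarrow> ('k :: field, real set \<times> nat \<Rightarrow> 'k) persistence_module" where
  "barcode_module B =
     pm_direct_sum {(I, m). m < count B I} (\<lambda>(I, m). interval_module I)"


section \<open>Simplicial homology of a filtration\<close>

text \<open>A simplicial complex is a family of finite nonempty sets of natural numbers, closed under
  nonempty subsets. A simplex is oriented by the order of its vertices, so a chain is a
  coefficient function on simplices.\<close>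

definition chains :: "nat set set \<Rightarrow> nat \<Rightarrow> (nat set \<Rightarrow> 'k :: field) set" where
  "chains K i = {c. finite {\<sigma>. c \<sigma> \<noteq> 0} \<and> (\<forall>\<sigma>. c \<sigma> \<noteq> 0 \<longrightarrow> \<sigma> \<in> K \<and> card \<sigma> = Suc i)}"

text \<open>For \<open>\<sigma> = {v\<^sub>0 < \<dots> < v\<^sub>i}\<close>, the boundary of \<open>\<sigma>\<close> is the sum of \<open>(-1) ^ j\<close> times
  \<open>\<sigma> - {v\<^sub>j}\<close>. Read off at a face \<open>\<tau>\<close>, the simplices that contribute are \<open>insert v \<tau>\<close>, where
  \<open>v\<close> has position \<open>card {u \<in> \<tau>. u < v}\<close>. The empty face is excluded, as homology is not
  reduced.\<close>

definition boundary :: "(nat set \<Rightarrow> 'k :: field) \<Rightarrow> nat set \<Rightarrow> 'k" where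
  "boundary c \<tau> = (if \<tau> = {} then 0 else
     \<Sum>v | v \<notin> \<tau> \<and> c (insert v \<tau>) \<noteq> 0. (-1) ^ card {u \<in> \<tau>. u < v} * c (insert v \<tau>))"

definition cycles :: "nat set set \<Rightarrow> nat \<Rightarrow> (nat set \<Rightarrow> 'k :: field) set" where
  "cycles K i = {c \<in> chains K i. boundary c = (\<lambda>_. 0)}"

definition boundaries :: "nat set set \<Rightarrow> nat \<Rightarrow> (nat set \<Rightarrow> 'k :: field) set" where
  "boundaries K i = boundary ` chains K (Suc i)"

definition homology_class ::
  "nat set set \<Rightarrow> nat \<Rightarrow> (nat set \<Rightarrow> 'k :: field) \<Rightarrow> (nat set \<Rightarrow> 'k) set" where
  "homology_class K i z = (\<lambda>b \<sigma>. z \<sigma> + b \<sigma>) ` boundaries K i"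

text \<open>The operations on homology classes are those of the quotient of cycles by boundaries;
  each union below is over the representatives of a class and all members of it coincide.\<close>

definition homology_module ::
  "(real \<Rightarrow> nat set set) \<Rightarrow> nat \<Rightarrow> ('k :: field, (nat set \<Rightarrow> 'k) set) persistence_module" where
  "homology_module X i =
    \<lparr> pm_space = (\<lambda>t. homology_class (X t) i ` cycles (X t) i),
      pm_add = (\<lambda>t A B. \<Union>x\<in>A. \<Union>y\<in>B. homology_class (X t) i (\<lambda>\<sigma>. x \<sigma> + y \<sigma>)),
      pm_scale = (\<lambda>t a A. \<Union>x\<in>A. homology_class (X t) i (\<lambda>\<sigma>. a * x \<sigma>)),
      pm_map = (\<lambda>s t A. \<Union>x\<in>A. homology_class (X t) i x) \<rparr>"

text \<open>The persistent homology is a relation here: \<open>D\<close> is determined uniquely by \<open>X\<close> whenever it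
  exists, because interval decompositions are unique.\<close>

definition persistent_homology_is ::
  "'k :: field itself \<Rightarrow> (real \<Rightarrow> nat set set) \<Rightarrow> (nat \<Rightarrow> real set multiset) \<Rightarrow> bool" where
  "persistent_homology_is F X D \<longleftrightarrow> full_barcode D \<and>
     (\<forall>i. pm_isomorphic (homology_module X i :: ('k, _) persistence_module) (barcode_module (D i)))"


section \<open>Point clouds and their filtrations\<close>

text \<open>The points of a cloud are labelled \<open>0, \<dots>, n - 1\<close>.\<close>

definition point_clouds :: "nat \<Rightarrow> (nat \<Rightarrow> real ^ 'd) set" where
  "point_clouds n = {P \<in> {..<n} \<rightarrow>\<^sub>E UNIV. inj_on P {..<n}}"

definition vietoris_rips :: "nat \<Rightarrow> (nat \<Rightarrow> real ^ 'd) \<Rightarrow> real \<Rightarrow> nat set set" where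
  "vietoris_rips n P r =
     {\<sigma>. \<sigma> \<noteq> {} \<and> \<sigma> \<subseteq> {..<n} \<and> (\<forall>i\<in>\<sigma>. \<forall>j\<in>\<sigma>. norm (P i - P j) \<le> 2 * r)}"

text \<open>The nerve of the closed balls of radius \<open>r\<close> around the points; by the nerve theorem this
  filtration has the persistent homology of the filtration by unions of these balls.\<close>

definition cech :: "nat \<Rightarrow> (nat \<Rightarrow> real ^ 'd) \<Rightarrow> real \<Rightarrow> nat set set" where
  "cech n P r =
     {\<sigma>. \<sigma> \<noteq> {} \<and> \<sigma> \<subseteq> {..<n} \<and> (\<exists>q. \<forall>i\<in>\<sigma>. norm (P i - q) \<le> r)}"

definition vr_fiber ::
  "'k :: field itself \<Rightarrow> nat \<Rightarrow> (nat \<Rightarrow> real set multiset) \<Rightarrow> (nat \<Rightarrow> real ^ 'd) set" where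
  "vr_fiber F n D = {P \<in> point_clouds n. persistent_homology_is F (vietoris_rips n P) D}"

definition cech_fiber ::
  "'k :: field itself \<Rightarrow> nat \<Rightarrow> (nat \<Rightarrow> real set multiset) \<Rightarrow> (nat \<Rightarrow> real ^ 'd) set" where
  "cech_fiber F n D = {P \<in> point_clouds n. persistent_homology_is F (cech n P) D}"


section \<open>Dimension of semialgebraic sets\<close>

text \<open>For a finite index set \<open>V\<close>, real affine space with coordinates in \<open>V\<close> is \<open>V \<rightarrow>\<^sub>E UNIV\<close>.\<close>

inductive_set polynomial_functions :: "'v set \<Rightarrow> (('v \<Rightarrow> real) \<Rightarrow> real) set" for V where
  const: "(\<lambda>x. c) \<in> polynomial_functions V"
| coord: "v \<in> V \<Longrightarrow> (\<lambda>x. x v) \<in> polynomial_functions V"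
| add: "f \<in> polynomial_functions V \<Longrightarrow> g \<in> polynomial_functions V \<Longrightarrow>
    (\<lambda>x. f x + g x) \<in> polynomial_functions V"
| mult: "f \<in> polynomial_functions V \<Longrightarrow> g \<in> polynomial_functions V \<Longrightarrow>
    (\<lambda>x. f x * g x) \<in> polynomial_functions V"

text \<open>The polynomial ring modulo the ideal of polynomials that vanish on \<open>S\<close>, realised as the
  ring of polynomial functions on \<open>S\<close>.\<close>

definition coordinate_ring :: "'v set \<Rightarrow> ('v \<Rightarrow> real) set \<Rightarrow> (('v \<Rightarrow> real) \<Rightarrow> real) ring" where
  "coordinate_ring V S =
    \<lparr> carrier = (\<lambda>f. restrict f S) ` polynomial_functions V,
      monoid.mult = (\<lambda>f g. \<lambda>x\<in>S. f x * g x),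
      one = (\<lambda>x\<in>S. 1),
      zero = (\<lambda>x\<in>S. 0),
      add = (\<lambda>f g. \<lambda>x\<in>S. f x + g x) \<rparr>"

text \<open>The zero ring has no prime ideal, hence Krull dimension \<open>-\<infinity>\<close>.\<close>

definition krull_dim :: "('a, 'b) ring_scheme \<Rightarrow> ereal" where
  "krull_dim R = (SUP k \<in> {k. \<exists>p :: nat \<Rightarrow> 'a set.
     (\<forall>i\<le>k. primeideal (p i) R) \<and> (\<forall>i<k. p i \<subset> p (Suc i))}. ereal (real k))"

text \<open>The dimension of a semialgebraic set is the Krull dimension of its ring of polynomial
  functions (Bochnak, Coste and Roy, Real Algebraic Geometry, Definition 2.8.1).\<close>

definition semialgebraic_dim :: "'v set \<Rightarrow> ('v \<Rightarrow> real) set \<Rightarrow> ereal" where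
  "semialgebraic_dim V S = krull_dim (coordinate_ring V S)"

definition cloud_coords :: "nat \<Rightarrow> (nat \<Rightarrow> real ^ 'd) \<Rightarrow> nat \<times> 'd \<Rightarrow> real" where
  "cloud_coords n P = (\<lambda>(i, a) \<in> {..<n} \<times> UNIV. P i $ a)"

definition cloud_dim :: "nat \<Rightarrow> (nat \<Rightarrow> real ^ 'd) set \<Rightarrow> ereal" where
  "cloud_dim n S = semialgebraic_dim ({..<n} \<times> UNIV) (cloud_coords n ` S)"

end

theory Submission
  imports Defs
begin

text \<open>The bound comes from the degree-zero barcode \<open>D 0\<close>. Degree-zero homology sees the
  vertices and edges of a complex, and the edge between two points enters both filtrations
  at half their distance. At parameter \<open>0\<close> the complex is a discrete set of points, all
  classes of degree zero come from there, and so \<open>D 0\<close> has one bar for each point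
  (\<open>number_of_bars\<close>). Given a partition of the points into two parts, let \<open>2 r\<close> be the
  distance between the parts. A class dies when they get connected, so \<open>r\<close> is the right
  endpoint of a bar (\<open>crossing_distance_is_death_time\<close>). Hence in every cloud of the fiber,
  each cut is crossed by a pair at a distance in a fixed finite set. This is the content of
  the familiar statement that the lengths of a minimum spanning tree are read off from
  \<open>D 0\<close>, and it says that, once the tree and the lengths are chosen, each of the \<open>n - 1\<close>
  points other than the root moves on a sphere around its parent: the dimension is at most
  \<open>d + (n - 1) (d - 1) = n d - n + 1\<close>.

  To turn this count into a bound on Krull dimension, consider a chain of primes in the ring
  of polynomial functions on the fiber, and let \<open>Q\<close> be the smallest one. As \<open>Q\<close> is prime,
  for each cut a single equation \<open>|p\<^sub>i - p\<^sub>j|\<^sup>2 = l\<^sup>2\<close> across the cut holds modulo \<open>Q\<close>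
  (\<open>cut_crossed_modulo_prime\<close>). These equations grow a tree modulo \<open>Q\<close>. Along the tree, the
  ring modulo \<open>Q\<close> is built from constants by adjoining \<open>n d - n + 1\<close> variables and \<open>n - 1\<close>
  square roots. Its Hilbert function therefore has degree at most \<open>m = n d - n + 1\<close>
  (\<open>filtration_of_cut_distances\<close>), and any \<open>k > m\<close> elements satisfy a polynomial relation
  modulo \<open>Q\<close> because they have more monomials than there is room for
  (\<open>filtration_forces_relation\<close>). On the other hand, elements that witness the strict
  inclusions of a chain of primes are algebraically independent modulo the smallest prime
  (\<open>chain_witnesses_independent\<close>), so the chain has length at most \<open>m\<close>
  (\<open>krull_dim_coordinate_ring_le\<close>).\<close>


section \<open>Underdetermined linear systems\<close>

lemma underdetermined_system_has_solution:
  fixes M :: "'a \<Rightarrow> 'b \<Rightarrow> 'k :: field"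
  assumes "finite B" "finite A" "card B < card A"
  shows "\<exists>c. (\<exists>a\<in>A. c a \<noteq> 0) \<and> (\<forall>b\<in>B. (\<Sum>a\<in>A. c a * M a b) = 0)"
  using assms
proof (induction B arbitrary: A M rule: finite_induct)
  case empty
  then obtain a where "a \<in> A" by fastforce
  then show ?case by (intro exI[of _ "\<lambda>_. 1"]) auto
next
  case (insert b B)
  show ?case
  proof (cases "\<forall>a\<in>A. M a b = 0")
    case True
    have "card B < card A" using insert by simp
    from insert.IH[OF insert.prems(1) this, of M] True show ?thesis by auto
  next
    case False
    then obtain p where p: "p \<in> A" "M p b \<noteq> 0" by auto
    \<comment> \<open>Gaussian elimination of the unknown \<open>p\<close> by means of the equation \<open>b\<close>\<close>
    define M' where "M' = (\<lambda>a x. M a x - M a b / M p b * M p x)"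
    have "card B < card (A - {p})" using insert p by auto
    from insert.IH[of "A - {p}" M', OF _ this] insert.prems(1)
    obtain c where c: "\<exists>a\<in>A - {p}. c a \<noteq> 0" "\<forall>x\<in>B. (\<Sum>a\<in>A - {p}. c a * M' a x) = 0"
      by auto
    define c' where "c' = (\<lambda>a. if a = p then - (\<Sum>a\<in>A - {p}. c a * M a b) / M p b else c a)"
    have *: "(\<Sum>a\<in>A. c' a * M a x) = (\<Sum>a\<in>A - {p}. c a * M' a x)" for x
    proof -
      have "(\<Sum>a\<in>A. c' a * M a x) = c' p * M p x + (\<Sum>a\<in>A - {p}. c' a * M a x)"
        using insert.prems(1) p(1) by (simp add: sum.remove)
      also have "(\<Sum>a\<in>A - {p}. c' a * M a x) = (\<Sum>a\<in>A - {p}. c a * M a x)"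
        by (rule sum.cong) (auto simp: c'_def)
      also have "c' p * M p x = - (\<Sum>a\<in>A - {p}. c a * (M a b / M p b * M p x))"
        by (simp add: c'_def sum_distrib_right sum_divide_distrib sum_negf mult.assoc)
      finally show ?thesis
        by (simp add: M'_def algebra_simps sum_subtractf)
    qed
    have "M' a b = 0" for a using p by (simp add: M'_def)
    then have "\<forall>x\<in>insert b B. (\<Sum>a\<in>A. c' a * M a x) = 0" using c(2) by (auto simp: *)
    moreover have "\<exists>a\<in>A. c' a \<noteq> 0" using c(1) by (auto simp: c'_def)
    ultimately show ?thesis by blast
  qed
qed


section \<open>Prime ideals of polynomial functions\<close>

lemma polynomial_functions_diff:
  assumes "f \<in> polynomial_functions V" "g \<in> polynomial_functions V"
  shows "(\<lambda>x. f x - g x) \<in> polynomial_functions V"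
proof -
  have "(\<lambda>x. f x + (\<lambda>x. (\<lambda>x. -1) x * g x) x) \<in> polynomial_functions V"
    by (intro polynomial_functions.intros assms)
  then show ?thesis by simp
qed

lemma polynomial_functions_sum:
  assumes "\<And>i. i \<in> I \<Longrightarrow> f i \<in> polynomial_functions V"
  shows "(\<lambda>x. \<Sum>i\<in>I. f i x) \<in> polynomial_functions V"
proof (cases "finite I")
  case True
  then show ?thesis using assms
    by (induction I rule: finite_induct) (auto intro: polynomial_functions.intros)
qed (auto intro: polynomial_functions.intros)

lemma polynomial_functions_prod:
  assumes "\<And>i. i \<in> I \<Longrightarrow> f i \<in> polynomial_functions V"
  shows "(\<lambda>x. \<Prod>i\<in>I. f i x) \<in> polynomial_functions V"
proof (cases "finite I")
  case True
  then show ?thesis using assms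
    by (induction I rule: finite_induct) (auto intro: polynomial_functions.intros)
qed (auto intro: polynomial_functions.intros)

lemma polynomial_functions_power:
  assumes "f \<in> polynomial_functions V"
  shows "(\<lambda>x. f x ^ t) \<in> polynomial_functions V"
  using assms by (induction t) (auto intro: polynomial_functions.intros)

text \<open>A prime of the coordinate ring of \<open>S\<close> is handled through its preimage \<open>Q\<close> among the
  polynomial functions on the whole affine space. In this way primes for different stages of
  the argument are compared as plain sets of functions, and \<open>S\<close> enters only through the fact
  that functions vanishing on \<open>S\<close> belong to \<open>Q\<close>.\<close>

locale prime_function_ideal =
  fixes V :: "'v set" and Q :: "(('v \<Rightarrow> real) \<Rightarrow> real) set"
  assumes Q_polynomial: "f \<in> Q \<Longrightarrow> f \<in> polynomial_functions V"
    and Q_zero: "(\<lambda>x. 0) \<in> Q"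
    and Q_proper: "(\<lambda>x. 1) \<notin> Q"
    and Q_add: "f \<in> Q \<Longrightarrow> g \<in> Q \<Longrightarrow> (\<lambda>x. f x + g x) \<in> Q"
    and Q_mult: "f \<in> polynomial_functions V \<Longrightarrow> g \<in> Q \<Longrightarrow> (\<lambda>x. f x * g x) \<in> Q"
    and Q_prime: "f \<in> polynomial_functions V \<Longrightarrow> g \<in> polynomial_functions V \<Longrightarrow>
      (\<lambda>x. f x * g x) \<in> Q \<Longrightarrow> f \<in> Q \<or> g \<in> Q"
begin

lemma Q_scale: "g \<in> Q \<Longrightarrow> (\<lambda>x. a * g x) \<in> Q"
  using Q_mult[OF polynomial_functions.const] .

lemma Q_diff: "f \<in> Q \<Longrightarrow> g \<in> Q \<Longrightarrow> (\<lambda>x. f x - g x) \<in> Q"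
  using Q_add[of f "\<lambda>x. (-1) * g x"] Q_scale[of g "-1"] by simp

lemma Q_sum:
  assumes "\<And>i. i \<in> I \<Longrightarrow> f i \<in> Q"
  shows "(\<lambda>x. \<Sum>i\<in>I. f i x) \<in> Q"
proof (cases "finite I")
  case True
  then show ?thesis using assms
  proof (induction I rule: finite_induct)
    case (insert i I)
    then show ?case using Q_add[of "f i" "\<lambda>x. \<Sum>i\<in>I. f i x"] by simp
  qed (simp add: Q_zero)
qed (simp add: Q_zero)

lemma Q_prime_prod:
  assumes "finite I" "\<And>i. i \<in> I \<Longrightarrow> f i \<in> polynomial_functions V"
    "(\<lambda>x. \<Prod>i\<in>I. f i x) \<in> Q"
  shows "\<exists>i\<in>I. f i \<in> Q"
  using assms
proof (induction I rule: finite_induct)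
  case empty
  then show ?case using Q_proper by simp
next
  case (insert i I)
  then have "(\<lambda>x. f i x * (\<Prod>i\<in>I. f i x)) \<in> Q" by simp
  then have "f i \<in> Q \<or> (\<lambda>x. \<Prod>i\<in>I. f i x) \<in> Q"
    by (intro Q_prime) (auto intro: insert polynomial_functions_prod)
  then show ?case using insert by auto
qed

lemma Q_prime_power:
  assumes "f \<in> polynomial_functions V" "f \<notin> Q" "g \<in> polynomial_functions V"
    "(\<lambda>x. f x ^ t * g x) \<in> Q"
  shows "g \<in> Q"
  using assms(4)
proof (induction t)
  case (Suc t)
  have "(\<lambda>x. f x * (f x ^ t * g x)) \<in> Q" using Suc.prems by (simp add: mult.assoc)
  moreover have "(\<lambda>x. f x ^ t * g x) \<in> polynomial_functions V"
    by (intro polynomial_functions.intros polynomial_functions_power assms)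
  ultimately show ?case using Q_prime[OF assms(1), of "\<lambda>x. f x ^ t * g x"] assms(2) Suc.IH by auto
qed simp

end

lemma prime_function_ideal_pullback:
  assumes "primeideal p (coordinate_ring V S)"
  shows "prime_function_ideal V {f \<in> polynomial_functions V. restrict f S \<in> p}"
proof -
  let ?R = "coordinate_ring V S"
  interpret primeideal p ?R by fact
  have carrier: "restrict f S \<in> carrier ?R" if "f \<in> polynomial_functions V" for f
    using that by (simp add: coordinate_ring_def)
  have mult: "restrict f S \<otimes>\<^bsub>?R\<^esub> restrict g S = restrict (\<lambda>x. f x * g x) S" for f g
    by (auto simp: coordinate_ring_def)
  have add: "restrict f S \<oplus>\<^bsub>?R\<^esub> restrict g S = restrict (\<lambda>x. f x + g x) S" for f g
    by (auto simp: coordinate_ring_def)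
  have one: "\<one>\<^bsub>?R\<^esub> = restrict (\<lambda>x. 1) S" by (simp add: coordinate_ring_def)
  have zero: "\<zero>\<^bsub>?R\<^esub> = restrict (\<lambda>x. 0) S" by (simp add: coordinate_ring_def)
  show ?thesis
  proof
    show "(\<lambda>x. 0) \<in> {f \<in> polynomial_functions V. restrict f S \<in> p}"
      using additive_subgroup.zero_closed[OF is_additive_subgroup] by (simp add: zero polynomial_functions.const)
    show "(\<lambda>x. 1) \<notin> {f \<in> polynomial_functions V. restrict f S \<in> p}"
      using one_imp_carrier I_notcarr by (auto simp: one)
  next
    fix f g
    assume "f \<in> {f \<in> polynomial_functions V. restrict f S \<in> p}"
      "g \<in> {f \<in> polynomial_functions V. restrict f S \<in> p}"
    then show "(\<lambda>x. f x + g x) \<in> {f \<in> polynomial_functions V. restrict f S \<in> p}"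
      using additive_subgroup.a_closed[OF is_additive_subgroup, of "restrict f S" "restrict g S"]
      by (auto simp: add intro: polynomial_functions.intros)
  next
    fix f g
    assume "f \<in> polynomial_functions V" "g \<in> {f \<in> polynomial_functions V. restrict f S \<in> p}"
    then show "(\<lambda>x. f x * g x) \<in> {f \<in> polynomial_functions V. restrict f S \<in> p}"
      using I_l_closed[OF _ carrier, of "restrict g S" f]
      by (auto simp: mult intro: polynomial_functions.intros)
  next
    fix f g
    assume "f \<in> polynomial_functions V" "g \<in> polynomial_functions V"
      "(\<lambda>x. f x * g x) \<in> {f \<in> polynomial_functions V. restrict f S \<in> p}"
    then show "f \<in> {f \<in> polynomial_functions V. restrict f S \<in> p} \<or>
        g \<in> {f \<in> polynomial_functions V. restrict f S \<in> p}"
      using I_prime[OF carrier carrier, of f g] by (auto simp: mult)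
  qed auto
qed

lemma primeideal_contains_vanishing:
  assumes "primeideal p (coordinate_ring V S)" "\<And>x. x \<in> S \<Longrightarrow> f x = 0"
  shows "restrict f S \<in> p"
proof -
  interpret primeideal p "coordinate_ring V S" by fact
  have "\<zero>\<^bsub>coordinate_ring V S\<^esub> = restrict f S"
    using assms(2) by (auto simp: coordinate_ring_def)
  then show ?thesis using additive_subgroup.zero_closed[OF is_additive_subgroup] by simp
qed


section \<open>Filtrations of polynomial growth\<close>

context prime_function_ideal
begin

definition span_mod :: "(('v \<Rightarrow> real) \<Rightarrow> real) set \<Rightarrow> (('v \<Rightarrow> real) \<Rightarrow> real) set" where
  "span_mod B = {f. \<exists>c. (\<lambda>x. f x - (\<Sum>b\<in>B. c b * b x)) \<in> Q}"

lemma span_mod_base: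
  assumes "finite B" "b \<in> B"
  shows "b \<in> span_mod B"
proof -
  have "(\<Sum>b'\<in>B. (if b' = b then 1 else 0) * b' x) = b x" for x
    using assms by (simp add: if_distrib[of "\<lambda>z. z * _"] sum.delta cong: if_cong)
  then show ?thesis
    unfolding span_mod_def using Q_zero
    by (auto intro!: exI[of _ "\<lambda>b'. if b' = b then 1 else 0"])
qed

lemma span_mod_zero: "(\<lambda>x. 0) \<in> span_mod B"
  unfolding span_mod_def using Q_zero by (auto intro!: exI[of _ "\<lambda>_. 0"])

lemma span_mod_add:
  assumes "f \<in> span_mod B" "g \<in> span_mod B"
  shows "(\<lambda>x. f x + g x) \<in> span_mod B"
proof -
  from assms obtain c c' where "(\<lambda>x. f x - (\<Sum>b\<in>B. c b * b x)) \<in> Q"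
    "(\<lambda>x. g x - (\<Sum>b\<in>B. c' b * b x)) \<in> Q" by (auto simp: span_mod_def)
  from Q_add[OF this] have "(\<lambda>x. f x + g x - (\<Sum>b\<in>B. (c b + c' b) * b x)) \<in> Q"
    by (simp add: algebra_simps sum.distrib)
  then show ?thesis by (auto simp: span_mod_def)
qed

lemma span_mod_scale:
  assumes "f \<in> span_mod B"
  shows "(\<lambda>x. a * f x) \<in> span_mod B"
proof -
  from assms obtain c where "(\<lambda>x. f x - (\<Sum>b\<in>B. c b * b x)) \<in> Q" by (auto simp: span_mod_def)
  from Q_scale[OF this, of a] have "(\<lambda>x. a * f x - (\<Sum>b\<in>B. (a * c b) * b x)) \<in> Q"
    by (simp add: algebra_simps sum_distrib_left)
  then show ?thesis by (auto simp: span_mod_def)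
qed

lemma span_mod_sum:
  assumes "\<And>i. i \<in> I \<Longrightarrow> f i \<in> span_mod B"
  shows "(\<lambda>x. \<Sum>i\<in>I. f i x) \<in> span_mod B"
proof (cases "finite I")
  case True
  then show ?thesis using assms
    by (induction I rule: finite_induct) (auto intro: span_mod_zero span_mod_add)
qed (auto intro: span_mod_zero)

lemma span_mod_cong:
  assumes "(\<lambda>x. f x - g x) \<in> Q" "g \<in> span_mod B"
  shows "f \<in> span_mod B"
proof -
  from assms(2) obtain c where "(\<lambda>x. g x - (\<Sum>b\<in>B. c b * b x)) \<in> Q" by (auto simp: span_mod_def)
  from Q_add[OF assms(1) this] show ?thesis by (auto simp: span_mod_def)
qed

lemma span_mod_mult:
  assumes "g \<in> polynomial_functions V" "f \<in> span_mod B"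
    and "\<And>b. b \<in> B \<Longrightarrow> (\<lambda>x. g x * b x) \<in> span_mod B'"
  shows "(\<lambda>x. g x * f x) \<in> span_mod B'"
proof -
  from assms(2) obtain c where "(\<lambda>x. f x - (\<Sum>b\<in>B. c b * b x)) \<in> Q" by (auto simp: span_mod_def)
  from Q_mult[OF assms(1) this]
  have "(\<lambda>x. g x * f x - (\<Sum>b\<in>B. c b * (g x * b x))) \<in> Q"
    by (simp add: algebra_simps sum_distrib_left)
  then show ?thesis
    by (rule span_mod_cong) (intro span_mod_sum span_mod_scale assms(3))
qed

lemma span_mod_mono:
  assumes "B \<subseteq> B'" "finite B'"
  shows "span_mod B \<subseteq> span_mod B'"
proof
  fix f assume f: "f \<in> span_mod B"
  have "(\<lambda>x. (\<lambda>x. 1) x * f x) \<in> span_mod B'"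
    by (rule span_mod_mult[OF polynomial_functions.const f]) (use span_mod_base assms in auto)
  then show "f \<in> span_mod B'" by simp
qed

text \<open>The span of \<open>B N\<close> modulo \<open>Q\<close> plays the role of the elements of degree at most \<open>N\<close>, and
  \<open>m\<close> bounds the degree of the Hilbert function.\<close>

definition filtration :: "nat \<Rightarrow> (nat \<Rightarrow> (('v \<Rightarrow> real) \<Rightarrow> real) set) \<Rightarrow> bool" where
  "filtration m B \<longleftrightarrow> (\<forall>N. finite (B N) \<and> B N \<subseteq> polynomial_functions V) \<and>
     (\<exists>C. \<forall>N. card (B N) \<le> C * Suc N ^ m) \<and> mono B \<and> (\<lambda>x. 1) \<in> B 0"

text \<open>Multiplication by \<open>f\<close> raises the degree by a bounded amount. This is closed under the
  ring operations, so it is enough to have it for generators.\<close>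

definition shift_by :: "(nat \<Rightarrow> (('v \<Rightarrow> real) \<Rightarrow> real) set) \<Rightarrow> nat \<Rightarrow> (('v \<Rightarrow> real) \<Rightarrow> real) \<Rightarrow> bool" where
  "shift_by B k f \<longleftrightarrow> f \<in> polynomial_functions V \<and>
     (\<forall>N. \<forall>b\<in>B N. (\<lambda>x. f x * b x) \<in> span_mod (B (N + k)))"

definition shifts :: "(nat \<Rightarrow> (('v \<Rightarrow> real) \<Rightarrow> real) set) \<Rightarrow> (('v \<Rightarrow> real) \<Rightarrow> real) \<Rightarrow> bool" where
  "shifts B f \<longleftrightarrow> (\<exists>k. shift_by B k f)"

lemma filtration_spans_mono:
  assumes "filtration m B" "N \<le> N'"
  shows "span_mod (B N) \<subseteq> span_mod (B N')"
  using assms by (intro span_mod_mono) (auto simp: filtration_def mono_def)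

lemma shift_by_mono:
  assumes "filtration m B" "shift_by B k f" "k \<le> k'"
  shows "shift_by B k' f"
  unfolding shift_by_def
proof (intro conjI allI ballI)
  show "f \<in> polynomial_functions V" using assms(2) by (simp add: shift_by_def)
  fix N b assume "b \<in> B N"
  then have "(\<lambda>x. f x * b x) \<in> span_mod (B (N + k))" using assms(2) by (simp add: shift_by_def)
  then show "(\<lambda>x. f x * b x) \<in> span_mod (B (N + k'))"
    using filtration_spans_mono[OF assms(1), of "N + k" "N + k'"] assms(3) by auto
qed

lemma shift_by_span:
  assumes "shift_by B k f" "g \<in> span_mod (B N)"
  shows "(\<lambda>x. f x * g x) \<in> span_mod (B (N + k))"
  by (rule span_mod_mult[OF _ assms(2)]) (use assms(1) in \<open>auto simp: shift_by_def\<close>)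

lemma shift_by_const:
  assumes "filtration m B"
  shows "shift_by B 0 (\<lambda>x. c)"
  using assms by (auto simp: shift_by_def filtration_def
      intro: polynomial_functions.const span_mod_scale span_mod_base)

lemma shift_by_mult:
  assumes "shift_by B k f" "shift_by B l g"
  shows "shift_by B (l + k) (\<lambda>x. f x * g x)"
proof -
  have "(\<lambda>x. f x * g x * b x) \<in> span_mod (B (N + (l + k)))" if "b \<in> B N" for b N
    using shift_by_span[OF assms(1), of "\<lambda>x. g x * b x" "N + l"] assms(2) that
    by (auto simp: shift_by_def mult.assoc add.assoc)
  then show ?thesis
    using assms by (auto simp: shift_by_def intro: polynomial_functions.mult)
qed

lemma shifts_const: "filtration m B \<Longrightarrow> shifts B (\<lambda>x. c)"
  using shift_by_const by (auto simp: shifts_def)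

lemma shifts_mult: "shifts B f \<Longrightarrow> shifts B g \<Longrightarrow> shifts B (\<lambda>x. f x * g x)"
  using shift_by_mult by (fastforce simp: shifts_def)

lemma shifts_add:
  assumes "filtration m B" "shifts B f" "shifts B g"
  shows "shifts B (\<lambda>x. f x + g x)"
proof -
  from assms(2,3) obtain k l where "shift_by B k f" "shift_by B l g" by (auto simp: shifts_def)
  then have *: "shift_by B (max k l) f" "shift_by B (max k l) g"
    using shift_by_mono[OF assms(1)] by auto
  have "(\<lambda>x. (f x + g x) * b x) \<in> span_mod (B (N + max k l))" if "b \<in> B N" for b N
    using span_mod_add[of "\<lambda>x. f x * b x" "B (N + max k l)" "\<lambda>x. g x * b x"] * that
    by (auto simp: shift_by_def distrib_right)
  then have "shift_by B (max k l) (\<lambda>x. f x + g x)"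
    using * by (auto simp: shift_by_def intro: polynomial_functions.add)
  then show ?thesis by (auto simp: shifts_def)
qed

lemma shifts_polynomial:
  assumes "filtration m B" "\<And>v. v \<in> V \<Longrightarrow> shifts B (\<lambda>x. x v)" "f \<in> polynomial_functions V"
  shows "shifts B f"
  using assms(3)
  by (induction) (auto intro: shifts_const[OF assms(1)] assms(2) shifts_add[OF assms(1)] shifts_mult)

lemma shifts_sum:
  assumes "filtration m B" "\<And>i. i \<in> I \<Longrightarrow> shifts B (f i)"
  shows "shifts B (\<lambda>x. \<Sum>i\<in>I. f i x)"
proof (cases "finite I")
  case True
  then show ?thesis using assms(2)
    by (induction I rule: finite_induct) (auto intro: shifts_const[OF assms(1)] shifts_add[OF assms(1)])
qed (auto intro: shifts_const[OF assms(1)])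

lemma filtration_trivial: "filtration m (\<lambda>N. {\<lambda>x. 1})"
  by (auto simp: filtration_def mono_def intro: polynomial_functions.const exI[of _ 1])

text \<open>The new sets contain \<open>g ^ t * b\<close> with \<open>t \<le> N\<close> and \<open>b\<close> old of degree \<open>N\<close>. There are
  \<open>N + 1\<close> choices for \<open>t\<close>, which raises the degree of growth by one.\<close>

lemma adjoin_variable:
  assumes B: "filtration m B" and g: "g \<in> polynomial_functions V"
  shows "\<exists>B'. filtration (Suc m) B' \<and> (\<forall>f. shifts B f \<longrightarrow> shifts B' f) \<and> shifts B' g"
proof -
  define B' where "B' N = (\<lambda>(t, b) x. g x ^ t * b x) ` ({..N} \<times> B N)" for N
  from B obtain C where C: "\<And>N. card (B N) \<le> C * Suc N ^ m" by (auto simp: filtration_def)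
  have fin: "finite (B N)" "finite (B' N)" for N using B by (auto simp: filtration_def B'_def)
  have poly: "B N \<subseteq> polynomial_functions V" for N using B by (auto simp: filtration_def)
  have mono: "B N \<subseteq> B N'" if "N \<le> N'" for N N' using B that by (auto simp: filtration_def mono_def)
  have mono': "B' N \<subseteq> B' N'" if "N \<le> N'" for N N'
    unfolding B'_def using mono[OF that] that by (intro image_mono Sigma_mono) auto
  have mem: "(\<lambda>x. g x ^ t * b x) \<in> B' N" if "t \<le> N" "b \<in> B N" for t b N
    unfolding B'_def by (rule image_eqI[of _ _ "(t, b)"]) (use that in auto)
  have card: "card (B' N) \<le> C * Suc N ^ Suc m" for N
  proof -
    have "card (B' N) \<le> Suc N * card (B N)"
      using card_image_le[of "{..N} \<times> B N" "\<lambda>(t, b) x. g x ^ t * b x"] fin(1)[of N]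
      by (simp add: B'_def)
    also have "\<dots> \<le> Suc N * (C * Suc N ^ m)" using C by (intro mult_left_mono) auto
    finally show ?thesis by (simp add: mult_ac)
  qed
  have "(\<lambda>x. 1) \<in> B' 0" using mem[of 0 0 "\<lambda>x. 1"] B by (auto simp: filtration_def)
  moreover have "B' N \<subseteq> polynomial_functions V" for N
    unfolding B'_def using g poly[of N]
    by (auto intro!: polynomial_functions.mult polynomial_functions_power)
  ultimately have "filtration (Suc m) B'"
    unfolding filtration_def using fin card mono' by (auto simp: mono_def)
  moreover have "shifts B' f" if f: "shifts B f" for f
  proof -
    from f obtain k where k: "shift_by B k f" by (auto simp: shifts_def)
    have "(\<lambda>x. f x * b' x) \<in> span_mod (B' (N + k))" if "b' \<in> B' N" for b' N
    proof -
      from that obtain t b where tb: "t \<le> N" "b \<in> B N" "b' = (\<lambda>x. g x ^ t * b x)"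
        by (auto simp: B'_def)
      have "(\<lambda>x. g x ^ t * (f x * b x)) \<in> span_mod (B' (N + k))"
      proof (rule span_mod_mult)
        show "(\<lambda>x. f x * b x) \<in> span_mod (B (N + k))" using k tb by (auto simp: shift_by_def)
        show "(\<lambda>x. g x ^ t * b x) \<in> span_mod (B' (N + k))" if "b \<in> B (N + k)" for b
          using mem[OF _ that, of t] tb(1) fin by (intro span_mod_base) auto
      qed (intro polynomial_functions_power g)
      then show ?thesis by (simp add: tb(3) mult_ac)
    qed
    then have "shift_by B' k f" using k by (auto simp: shift_by_def)
    then show ?thesis by (auto simp: shifts_def)
  qed
  moreover have "shifts B' g"
  proof -
    have "(\<lambda>x. g x * b' x) \<in> span_mod (B' (N + 1))" if "b' \<in> B' N" for b' N
    proof -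
      from that obtain t b where tb: "t \<le> N" "b \<in> B N" "b' = (\<lambda>x. g x ^ t * b x)"
        by (auto simp: B'_def)
      have "(\<lambda>x. g x ^ Suc t * b x) \<in> span_mod (B' (N + 1))"
        using mem[of "Suc t" "N + 1" b] tb mono[of N "N + 1"] fin by (intro span_mod_base) auto
      then show ?thesis by (simp add: tb(3) mult_ac)
    qed
    then have "shift_by B' 1 g" using g by (auto simp: shift_by_def)
    then show ?thesis by (auto simp: shifts_def)
  qed
  ultimately show ?thesis by blast
qed

lemma adjoin_variables:
  assumes "finite I" "filtration m B" "\<And>i. i \<in> I \<Longrightarrow> g i \<in> polynomial_functions V"
  shows "\<exists>B'. filtration (m + card I) B' \<and> (\<forall>f. shifts B f \<longrightarrow> shifts B' f) \<and>
    (\<forall>i\<in>I. shifts B' (g i))"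
  using assms(1,3)
proof (induction I rule: finite_induct)
  case empty
  then show ?case using assms(2) by auto
next
  case (insert i I)
  then obtain B' where B': "filtration (m + card I) B'" "\<forall>f. shifts B f \<longrightarrow> shifts B' f"
    "\<forall>i\<in>I. shifts B' (g i)" by auto
  obtain B'' where B'': "filtration (Suc (m + card I)) B''" "\<forall>f. shifts B' f \<longrightarrow> shifts B'' f"
    "shifts B'' (g i)" using adjoin_variable[OF B'(1), of "g i"] insert by auto
  then have "filtration (m + card (insert i I)) B''" using insert by simp
  then show ?case using B' B'' by blast
qed

text \<open>If \<open>e\<^sup>2\<close> is congruent to \<open>h\<close>, powers of \<open>e\<close> above the first reduce to the old ring, so
  \<open>B N\<close> together with \<open>e * B N\<close> suffices. The sets at most double in size, and the degree of
  growth stays the same.\<close>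

lemma adjoin_square_root:
  assumes B: "filtration m B" and e: "e \<in> polynomial_functions V" and h: "shifts B h"
    and eh: "(\<lambda>x. e x * e x - h x) \<in> Q"
  shows "\<exists>B'. filtration m B' \<and> (\<forall>f. shifts B f \<longrightarrow> shifts B' f) \<and> shifts B' e"
proof -
  define B' where "B' N = B N \<union> (\<lambda>b x. e x * b x) ` B N" for N
  from B obtain C where C: "\<And>N. card (B N) \<le> C * Suc N ^ m" by (auto simp: filtration_def)
  have fin: "finite (B N)" "finite (B' N)" for N using B by (auto simp: filtration_def B'_def)
  have poly: "B N \<subseteq> polynomial_functions V" for N using B by (auto simp: filtration_def)
  have mono: "B N \<subseteq> B N'" if "N \<le> N'" for N N' using B that by (auto simp: filtration_def mono_def)
  have mono': "B' N \<subseteq> B' N'" if "N \<le> N'" for N N'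
    unfolding B'_def using mono[OF that] by blast
  have card: "card (B' N) \<le> 2 * C * Suc N ^ m" for N
  proof -
    have "card (B' N) \<le> card (B N) + card (B N)"
      unfolding B'_def using card_Un_le card_image_le[OF fin(1)] by (meson add_left_mono order_trans)
    then show ?thesis using C[of N] by simp
  qed
  have "filtration m B'"
    unfolding filtration_def
  proof (intro conjI allI exI)
    show "B' N \<subseteq> polynomial_functions V" for N
      unfolding B'_def using e poly[of N] by (auto intro!: polynomial_functions.mult)
    show "mono B'" using mono' by (auto simp: mono_def)
    show "(\<lambda>x. 1) \<in> B' 0" using B by (auto simp: filtration_def B'_def)
  qed (use fin card in auto)
  moreover have old: "shifts B' f" if f: "shifts B f" for f
  proof -
    from f obtain k where k: "shift_by B k f" by (auto simp: shifts_def)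
    have "(\<lambda>x. f x * b' x) \<in> span_mod (B' (N + k))" if b': "b' \<in> B' N" for b' N
    proof -
      have *: "(\<lambda>x. f x * b x) \<in> span_mod (B (N + k))" if "b \<in> B N" for b
        using k that by (auto simp: shift_by_def)
      have sub: "span_mod (B (N + k)) \<subseteq> span_mod (B' (N + k))"
        by (intro span_mod_mono fin) (auto simp: B'_def)
      have "(\<lambda>x. f x * (e x * b x)) \<in> span_mod (B' (N + k))" if b: "b \<in> B N" for b
      proof -
        have "(\<lambda>x. e x * (f x * b x)) \<in> span_mod (B' (N + k))"
          by (rule span_mod_mult[OF e *[OF b]]) (auto intro: span_mod_base fin simp: B'_def)
        then show ?thesis by (simp add: mult_ac)
      qed
      then show ?thesis using b' * sub by (auto simp: B'_def)
    qed
    then have "shift_by B' k f" using k by (auto simp: shift_by_def)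
    then show ?thesis by (auto simp: shifts_def)
  qed
  moreover have "shifts B' e"
  proof -
    from h obtain k where k: "shift_by B k h" by (auto simp: shifts_def)
    have "(\<lambda>x. e x * b' x) \<in> span_mod (B' (N + k))" if b': "b' \<in> B' N" for b' N
    proof -
      have "(\<lambda>x. e x * b x) \<in> span_mod (B' (N + k))" if "b \<in> B N" for b
        using that mono[of N "N + k"] by (intro span_mod_base fin) (auto simp: B'_def)
      moreover have "(\<lambda>x. e x * (e x * b x)) \<in> span_mod (B' (N + k))" if b: "b \<in> B N" for b
      proof (rule span_mod_cong)
        have "(\<lambda>x. b x * (e x * e x - h x)) \<in> Q" using Q_mult[OF _ eh] b poly by auto
        then show "(\<lambda>x. e x * (e x * b x) - h x * b x) \<in> Q" by (simp add: algebra_simps)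
        have "(\<lambda>x. h x * b x) \<in> span_mod (B (N + k))" using k b by (auto simp: shift_by_def)
        then show "(\<lambda>x. h x * b x) \<in> span_mod (B' (N + k))"
          using span_mod_mono[of "B (N + k)" "B' (N + k)"] fin by (auto simp: B'_def)
      qed
      ultimately show ?thesis using b' by (auto simp: B'_def)
    qed
    then have "shift_by B' k e" using e by (auto simp: shift_by_def)
    then show ?thesis by (auto simp: shifts_def)
  qed
  ultimately show ?thesis by blast
qed

end

section \<open>Chains of prime ideals\<close>

definition exponents :: "nat \<Rightarrow> nat \<Rightarrow> nat list set" where
  "exponents M k = {a. set a \<subseteq> {..<M} \<and> length a = k}"

definition monomial :: "(nat \<Rightarrow> 'a \<Rightarrow> real) \<Rightarrow> nat list \<Rightarrow> 'a \<Rightarrow> real" where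
  "monomial f a x = (\<Prod>i<length a. f i x ^ (a ! i))"

lemma monomial_Nil [simp]: "monomial f [] x = 1"
  by (simp add: monomial_def)

lemma monomial_Cons [simp]: "monomial f (t # a) x = f 0 x ^ t * monomial (\<lambda>i. f (Suc i)) a x"
  by (simp add: monomial_def prod.lessThan_Suc_shift del: prod.lessThan_Suc)

lemma finite_exponents [simp]: "finite (exponents M k)"
  unfolding exponents_def by (rule finite_lists_length_eq) simp

lemma card_exponents: "card (exponents M k) = M ^ k"
  unfolding exponents_def by (subst card_lists_length_eq) auto

lemma exponents_0 [simp]: "exponents M 0 = {[]}"
  by (auto simp: exponents_def)

lemma sum_list_exponents_le: "a \<in> exponents M k \<Longrightarrow> sum_list a \<le> M * k"
  by (induction a arbitrary: k) (fastforce simp: exponents_def)+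

lemma sum_exponents_Suc:
  "(\<Sum>a\<in>exponents M (Suc k). h a) = (\<Sum>t<M. \<Sum>a\<in>exponents M k. h (t # a))"
proof -
  have "exponents M (Suc k) = (\<lambda>(t, a). t # a) ` ({..<M} \<times> exponents M k)"
  proof (intro equalityI subsetI)
    fix a assume "a \<in> exponents M (Suc k)"
    then show "a \<in> (\<lambda>(t, a). t # a) ` ({..<M} \<times> exponents M k)"
      by (cases a) (auto simp: exponents_def image_iff)
  qed (auto simp: exponents_def)
  then have "(\<Sum>a\<in>exponents M (Suc k). h a) = (\<Sum>(t, a)\<in>{..<M} \<times> exponents M k. h (t # a))"
    by (simp add: sum.reindex inj_on_def split_def)
  then show ?thesis by (simp add: sum.cartesian_product)
qed

lemma polynomial_functions_monomial:
  assumes "\<And>i. i < length a \<Longrightarrow> f i \<in> polynomial_functions V"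
  shows "monomial f a \<in> polynomial_functions V"
proof -
  have "(\<lambda>x. monomial f a x) \<in> polynomial_functions V"
    unfolding monomial_def by (intro polynomial_functions_prod polynomial_functions_power assms) auto
  then show ?thesis by simp
qed

text \<open>In a relation between the witnesses \<open>f i\<close>, let \<open>t\<close> be the least exponent of \<open>f 0\<close>. As
  \<open>f 0\<close> is not in the smallest prime, \<open>f 0 ^ t\<close> can be cancelled; modulo the next prime
  \<open>f 0\<close> vanishes, and what is left is the coefficient of \<open>f 0 ^ t\<close>, which is a relation
  between the other witnesses.\<close>

lemma chain_witnesses_independent:
  assumes "\<And>i. i \<le> k \<Longrightarrow> prime_function_ideal V (Q i)"
    and "\<And>i. i < k \<Longrightarrow> Q i \<subseteq> Q (Suc i)"
    and "\<And>i. i < k \<Longrightarrow> f i \<in> Q (Suc i) - Q i"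
    and "(\<lambda>x. \<Sum>a\<in>exponents M k. c a * monomial f a x) \<in> Q 0"
    and "a \<in> exponents M k"
  shows "c a = 0"
  using assms
proof (induction k arbitrary: Q f c a)
  case 0
  interpret prime_function_ideal V "Q 0" using 0 by simp
  have "(\<lambda>x. c []) \<in> Q 0" using 0 by simp
  from Q_scale[OF this, of "1 / c []"] Q_proper have "c [] = 0" by (cases "c [] = 0") auto
  then show ?case using 0 by simp
next
  case (Suc k)
  interpret Q0: prime_function_ideal V "Q 0" using Suc.prems by simp
  interpret Q1: prime_function_ideal V "Q 1" using Suc.prems(1)[of 1] by simp
  let ?f' = "\<lambda>i. f (Suc i)"
  define g where "g t = (\<lambda>x. \<Sum>a\<in>exponents M k. c (t # a) * monomial ?f' a x)" for t
  have f_poly: "f i \<in> polynomial_functions V" if "i < Suc k" for i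
    using Suc.prems(1)[of "Suc i"] Suc.prems(3)[of i] that
    by (auto dest: prime_function_ideal.Q_polynomial)
  have g_poly: "g t \<in> polynomial_functions V" for t
    unfolding g_def
    by (intro polynomial_functions_sum polynomial_functions.mult polynomial_functions.const
        polynomial_functions_monomial f_poly) (auto simp: exponents_def)
  have rel: "(\<lambda>x. \<Sum>t<M. f 0 x ^ t * g t x) \<in> Q 0"
    using Suc.prems(4) by (simp add: sum_exponents_Suc g_def sum_distrib_left mult_ac)
  have "\<forall>a\<in>exponents M k. c (t # a) = 0" if "t < M" for t
    using that
  proof (induction t rule: less_induct)
    case (less t)
    then have vanish: "g s x = 0" if "s < t" for s x
      using that by (simp add: g_def)
    define r where "r = (\<lambda>x. \<Sum>s\<in>{Suc t..<M}. f 0 x ^ (s - Suc t) * g s x)"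
    have r_poly: "r \<in> polynomial_functions V"
      unfolding r_def
      by (intro polynomial_functions_sum polynomial_functions.mult polynomial_functions_power
          g_poly f_poly) auto
    have "(\<Sum>s<M. f 0 x ^ s * g s x) = f 0 x ^ t * (g t x + f 0 x * r x)" for x
    proof -
      have "{..<M} = {..<t} \<union> ({t} \<union> {Suc t..<M})" using less.prems by auto
      then have "(\<Sum>s<M. f 0 x ^ s * g s x) = (\<Sum>s\<in>{..<t} \<union> ({t} \<union> {Suc t..<M}). f 0 x ^ s * g s x)"
        by simp
      also have "\<dots> = (\<Sum>s<t. f 0 x ^ s * g s x) +
          (f 0 x ^ t * g t x + (\<Sum>s\<in>{Suc t..<M}. f 0 x ^ s * g s x))"
        by (subst sum.union_disjoint; auto)+
      also have "(\<Sum>s<t. f 0 x ^ s * g s x) = 0" by (simp add: vanish)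
      also have "(\<Sum>s\<in>{Suc t..<M}. f 0 x ^ s * g s x) = f 0 x ^ t * (f 0 x * r x)"
        unfolding r_def sum_distrib_left
      proof (rule sum.cong)
        fix s assume "s \<in> {Suc t..<M}"
        then have "f 0 x ^ s = f 0 x ^ Suc t * f 0 x ^ (s - Suc t)"
          unfolding power_add[symmetric] by simp
        then show "f 0 x ^ s * g s x = f 0 x ^ t * (f 0 x * (f 0 x ^ (s - Suc t) * g s x))"
          by (simp add: mult_ac)
      qed simp
      finally show ?thesis by (simp add: algebra_simps)
    qed
    then have "(\<lambda>x. f 0 x ^ t * (g t x + f 0 x * r x)) \<in> Q 0" using rel by simp
    then have "(\<lambda>x. g t x + f 0 x * r x) \<in> Q 0"
      by (rule Q0.Q_prime_power[rotated -1])
        (use f_poly g_poly r_poly Suc.prems(3)[of 0] in \<open>auto intro!: polynomial_functions.intros\<close>)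
    then have 1: "(\<lambda>x. g t x + f 0 x * r x) \<in> Q 1" using Suc.prems(2)[of 0] by auto
    have "(\<lambda>x. r x * f 0 x) \<in> Q 1" using Q1.Q_mult[OF r_poly] Suc.prems(3)[of 0] by auto
    from Q1.Q_diff[OF 1 this] have "g t \<in> Q 1" by (simp add: algebra_simps)
    then have *: "(\<lambda>x. \<Sum>a\<in>exponents M k. c (t # a) * monomial ?f' a x) \<in> Q (Suc 0)"
      by (simp add: g_def)
    show ?case
    proof
      fix a assume "a \<in> exponents M k"
      with * show "c (t # a) = 0"
        by (intro Suc.IH[of "\<lambda>i. Q (Suc i)" ?f' "\<lambda>a. c (t # a)" a])
          (use Suc.prems in auto)
    qed
  qed
  then show ?case using Suc.prems(5) by (cases a) (auto simp: exponents_def)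
qed

context prime_function_ideal
begin

lemma shift_by_power:
  assumes "filtration m B" "shift_by B k f"
  shows "shift_by B (t * k) (\<lambda>x. f x ^ t)"
proof (induction t)
  case 0
  then show ?case using shift_by_const[OF assms(1), of 1] by simp
next
  case (Suc t)
  then show ?case using shift_by_mult[OF Suc.IH assms(2)] by (simp add: mult.commute)
qed

lemma shift_by_monomial:
  assumes "filtration m B" "\<And>i. i < length a \<Longrightarrow> shift_by B k (f i)"
  shows "shift_by B (sum_list a * k) (monomial f a)"
  using assms(2)
proof (induction a arbitrary: f)
  case Nil
  have "monomial f [] = (\<lambda>x. 1)" by auto
  then show ?case using shift_by_const[OF assms(1), of 1] by simp
next
  case (Cons t a)
  have "shift_by B (sum_list a * k) (monomial (\<lambda>i. f (Suc i)) a)"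
    using Cons.prems by (intro Cons.IH) auto
  moreover have "shift_by B (t * k) (\<lambda>x. f 0 x ^ t)"
    using Cons.prems[of 0] by (intro shift_by_power[OF assms(1)]) auto
  ultimately have "shift_by B (sum_list a * k + t * k)
      (\<lambda>x. f 0 x ^ t * monomial (\<lambda>i. f (Suc i)) a x)"
    by (rule shift_by_mult[rotated])
  moreover have "monomial f (t # a) = (\<lambda>x. f 0 x ^ t * monomial (\<lambda>i. f (Suc i)) a x)" by auto
  ultimately show ?case by (simp add: algebra_simps)
qed

text \<open>The \<open>M ^ k\<close> monomials with exponents below \<open>M\<close> lie in the span of a set of size
  \<open>O(M ^ m)\<close>, so for \<open>k > m\<close> and large \<open>M\<close> they satisfy a linear relation.\<close>

lemma filtration_forces_relation:
  assumes B: "filtration m B" and f: "\<And>i. i < k \<Longrightarrow> shifts B (f i)" and k: "m < k"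
  shows "\<exists>M c. (\<exists>a\<in>exponents M k. c a \<noteq> 0) \<and>
    (\<lambda>x. \<Sum>a\<in>exponents M k. c a * monomial f a x) \<in> Q"
proof -
  from f have "\<forall>i. \<exists>l. i < k \<longrightarrow> shift_by B l (f i)" by (auto simp: shifts_def)
  then obtain l where l: "\<And>i. i < k \<Longrightarrow> shift_by B (l i) (f i)" by metis
  \<comment> \<open>a common bound for the amounts by which the \<open>f i\<close> raise the degree\<close>
  define L where "L = (\<Sum>i<k. l i)"
  have L: "shift_by B L (f i)" if "i < k" for i
    using l[OF that] by (rule shift_by_mono[OF B]) (use that in \<open>auto simp: L_def intro: member_le_sum\<close>)
  from B obtain C where C: "\<And>N. card (B N) \<le> C * Suc N ^ m" by (auto simp: filtration_def)
  \<comment> \<open>\<open>N\<close> bounds the degree of the monomials, and \<open>M\<close> exceeds the factor in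
    \<open>card (B N) \<le> C * Suc (k * L) ^ m * M ^ m\<close>\<close>
  define M where "M = Suc (C * Suc (k * L) ^ m)"
  define N where "N = M * k * L"
  have fin: "finite (B N)" using B by (auto simp: filtration_def)
  have span: "monomial f a \<in> span_mod (B N)" if "a \<in> exponents M k" for a
  proof -
    have len: "length a = k" and bound: "sum_list a \<le> M * k"
      using that sum_list_exponents_le by (auto simp: exponents_def)
    have one: "(\<lambda>x. 1) \<in> B 0" using B by (auto simp: filtration_def)
    have "shift_by B (sum_list a * L) (monomial f a)"
      using shift_by_monomial[OF B] L len by blast
    from shift_by_span[OF this, of "\<lambda>x. 1" 0] one
    have "monomial f a \<in> span_mod (B (sum_list a * L))"
      using B by (simp add: span_mod_base filtration_def)
    then show ?thesis
      using filtration_spans_mono[OF B, of "sum_list a * L" N] mult_right_mono[OF bound, of L]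
      by (auto simp: N_def)
  qed
  then have "\<forall>a\<in>exponents M k. \<exists>e. (\<lambda>x. monomial f a x - (\<Sum>b\<in>B N. e b * b x)) \<in> Q"
    by (auto simp: span_mod_def)
  from bchoice[OF this] obtain e where e: "\<And>a. a \<in> exponents M k \<Longrightarrow>
      (\<lambda>x. monomial f a x - (\<Sum>b\<in>B N. e a b * b x)) \<in> Q" by blast
  have "card (B N) < card (exponents M k)"
  proof -
    have "1 \<le> M" by (simp add: M_def)
    then have "Suc N \<le> M * Suc (k * L)" by (simp add: N_def mult.assoc)
    then have "Suc N ^ m \<le> (M * Suc (k * L)) ^ m" by (rule power_mono) simp
    then have "card (B N) \<le> C * (M * Suc (k * L)) ^ m"
      using C[of N] by (meson le_trans mult_le_mono2)
    also have "\<dots> = (C * Suc (k * L) ^ m) * M ^ m" by (simp only: power_mult_distrib mult_ac)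
    also have "\<dots> < M * M ^ m" by (rule mult_strict_right_mono) (auto simp: M_def)
    also have "\<dots> = M ^ Suc m" by simp
    also have "\<dots> \<le> M ^ k" using k by (intro power_increasing) (auto simp: M_def)
    finally show ?thesis by (simp add: card_exponents)
  qed
  from underdetermined_system_has_solution[OF fin finite_exponents this, of e]
  obtain c where c: "\<exists>a\<in>exponents M k. c a \<noteq> 0"
    "\<forall>b\<in>B N. (\<Sum>a\<in>exponents M k. c a * e a b) = 0" by auto
  have "(\<lambda>x. \<Sum>a\<in>exponents M k. c a * (monomial f a x - (\<Sum>b\<in>B N. e a b * b x))) \<in> Q"
    by (intro Q_sum Q_scale e)
  moreover have "(\<Sum>a\<in>exponents M k. c a * (monomial f a x - (\<Sum>b\<in>B N. e a b * b x))) =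
      (\<Sum>a\<in>exponents M k. c a * monomial f a x)" for x
  proof -
    have "(\<Sum>a\<in>exponents M k. c a * (\<Sum>b\<in>B N. e a b * b x)) =
        (\<Sum>b\<in>B N. (\<Sum>a\<in>exponents M k. c a * e a b) * b x)"
      unfolding sum_distrib_left sum_distrib_right by (subst sum.swap) (simp add: mult.assoc)
    then show ?thesis using c(2) by (simp add: right_diff_distrib sum_subtractf)
  qed
  ultimately show ?thesis using c(1) by auto
qed

end

text \<open>The witnesses of a chain of length \<open>k > m\<close> would be algebraically independent modulo the
  smallest prime, while growth of degree \<open>m\<close> forces a relation between them.\<close>

theorem krull_dim_coordinate_ring_le:
  assumes "\<And>Q. prime_function_ideal V Q \<Longrightarrow>
      (\<And>f. f \<in> polynomial_functions V \<Longrightarrow> (\<And>x. x \<in> S \<Longrightarrow> f x = 0) \<Longrightarrow> f \<in> Q) \<Longrightarrow>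
      \<exists>B. prime_function_ideal.filtration V m B \<and>
        (\<forall>v\<in>V. prime_function_ideal.shifts V Q B (\<lambda>x. x v))"
  shows "krull_dim (coordinate_ring V S) \<le> ereal (real m)"
  unfolding krull_dim_def
proof (rule SUP_least)
  let ?R = "coordinate_ring V S"
  fix k assume "k \<in> {k. \<exists>p. (\<forall>i\<le>k. primeideal (p i) ?R) \<and> (\<forall>i<k. p i \<subset> p (Suc i))}"
  then obtain p where p: "\<And>i. i \<le> k \<Longrightarrow> primeideal (p i) ?R" "\<And>i. i < k \<Longrightarrow> p i \<subset> p (Suc i)"
    by auto
  define Q where "Q i = {f \<in> polynomial_functions V. restrict f S \<in> p i}" for i
  have prime: "prime_function_ideal V (Q i)" if "i \<le> k" for i
    unfolding Q_def by (intro prime_function_ideal_pullback p that)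
  have incl: "Q i \<subseteq> Q (Suc i)" if "i < k" for i using p(2)[OF that] by (auto simp: Q_def)
  have "\<exists>f. f \<in> Q (Suc i) - Q i" if i: "i < k" for i
  proof -
    from p(2)[OF i] obtain h where h: "h \<in> p (Suc i)" "h \<notin> p i" by auto
    interpret primeideal "p (Suc i)" ?R using p(1)[of "Suc i"] i by simp
    from h(1) have "h \<in> carrier ?R" using additive_subgroup.a_subset[OF is_additive_subgroup] by auto
    then obtain f where "f \<in> polynomial_functions V" "h = restrict f S"
      by (auto simp: coordinate_ring_def)
    then show ?thesis using h by (auto simp: Q_def)
  qed
  then obtain f where f: "\<And>i. i < k \<Longrightarrow> f i \<in> Q (Suc i) - Q i" by metis
  interpret prime_function_ideal V "Q 0" using prime by simp
  have "h \<in> Q 0" if "h \<in> polynomial_functions V" "\<And>x. x \<in> S \<Longrightarrow> h x = 0" for h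
    using that primeideal_contains_vanishing[OF p(1), of 0 h] by (auto simp: Q_def)
  then obtain B where B: "filtration m B" "\<forall>v\<in>V. shifts B (\<lambda>x. x v)"
    using assms[OF prime_function_ideal_axioms] by auto
  have shifts: "shifts B (f i)" if "i < k" for i
    by (rule shifts_polynomial[OF B(1)]) (use B(2) f[OF that] in \<open>auto simp: Q_def\<close>)
  have "\<not> m < k"
  proof
    assume "m < k"
    then have "\<exists>M c. (\<exists>a\<in>exponents M k. c a \<noteq> 0) \<and>
        (\<lambda>x. \<Sum>a\<in>exponents M k. c a * monomial f a x) \<in> Q 0"
      using filtration_forces_relation[OF B(1), of k f] shifts by simp
    then obtain M c a where a: "a \<in> exponents M k" "c a \<noteq> 0"
      and rel: "(\<lambda>x. \<Sum>a\<in>exponents M k. c a * monomial f a x) \<in> Q 0" by auto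
    from chain_witnesses_independent[where Q = Q and f = f, OF prime incl f rel a(1)] a(2)
    show False by simp
  qed
  then show "ereal (real k) \<le> ereal (real m)" by simp
qed

section \<open>Sets of clouds with prescribed distances across every cut\<close>

text \<open>For a fixed cut, the product of the functions \<open>|p\<^sub>i - p\<^sub>j|\<^sup>2 - l\<^sup>2\<close> over all crossing
  pairs and all \<open>l \<in> L\<close> vanishes on the whole set, because every cloud has a crossing pair
  at a distance in \<open>L\<close>. A prime that contains the product contains one of the factors.\<close>

lemma cut_crossed_modulo_prime:
  fixes S :: "(nat \<Rightarrow> real ^ 'd :: finite) set"
  assumes "prime_function_ideal ({..<n} \<times> UNIV) Q"
    and vanish: "\<And>f. f \<in> polynomial_functions ({..<n} \<times> UNIV) \<Longrightarrow>
      (\<And>x. x \<in> cloud_coords n ` S \<Longrightarrow> f x = 0) \<Longrightarrow> f \<in> Q"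
    and L: "finite L"
    and cut: "\<And>P. P \<in> S \<Longrightarrow> \<exists>i\<in>A. \<exists>j\<in>{..<n} - A. norm (P i - P j) \<in> L"
    and A: "A \<subseteq> {..<n}"
  shows "\<exists>i\<in>A. \<exists>j\<in>{..<n} - A. \<exists>l\<in>L. (\<lambda>x. (\<Sum>a\<in>UNIV. (x (j, a) - x (i, a))\<^sup>2) - l\<^sup>2) \<in> Q"
proof -
  interpret prime_function_ideal "{..<n} \<times> UNIV" Q by fact
  define h :: "nat \<times> nat \<times> real \<Rightarrow> (nat \<times> 'd \<Rightarrow> real) \<Rightarrow> real" where
    "h = (\<lambda>(i, j, l) x. (\<Sum>a\<in>UNIV. (x (j, a) - x (i, a))\<^sup>2) - l\<^sup>2)"
  let ?I = "A \<times> ({..<n} - A) \<times> L"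
  have fin: "finite ?I" using A L by (auto intro: finite_subset)
  have poly: "h e \<in> polynomial_functions ({..<n} \<times> UNIV)" if "e \<in> ?I" for e
    using that A unfolding h_def
    by (auto split: prod.splits intro!: polynomial_functions_diff polynomial_functions_sum
        polynomial_functions_power polynomial_functions.const polynomial_functions.coord)
  have "(\<lambda>x. \<Prod>e\<in>?I. h e x) \<in> Q"
  proof (rule vanish)
    show "(\<lambda>x. \<Prod>e\<in>?I. h e x) \<in> polynomial_functions ({..<n} \<times> UNIV)"
      using poly by (rule polynomial_functions_prod)
    fix x assume "x \<in> cloud_coords n ` S"
    then obtain P where P: "P \<in> S" "x = cloud_coords n P" by auto
    from cut[OF P(1)] obtain i j where ij: "i \<in> A" "j \<in> {..<n} - A" "norm (P i - P j) \<in> L" by auto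
    have coords: "x (i, a) = P i $ a" "x (j, a) = P j $ a" for a
      using ij A P(2) by (auto simp: cloud_coords_def)
    have "(\<Sum>a\<in>UNIV. (x (j, a) - x (i, a))\<^sup>2) = (norm (P j - P i))\<^sup>2"
      unfolding coords power2_norm_eq_inner by (simp add: inner_vec_def power2_eq_square)
    then have "h (i, j, norm (P i - P j)) x = 0" by (simp add: h_def norm_minus_commute)
    then show "(\<Prod>e\<in>?I. h e x) = 0" using ij fin by (intro prod_zero) auto
  qed
  from Q_prime_prod[OF fin poly this] show ?thesis by (auto simp: h_def)
qed

text \<open>Placing one more point at a fixed distance from an old one adjoins \<open>d - 1\<close> free
  coordinates of the difference vector; the square of the remaining coordinate is a
  polynomial in these.\<close>

lemma (in prime_function_ideal) adjoin_point_at_distance: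
  fixes u w :: "'d :: finite \<Rightarrow> ('v \<Rightarrow> real) \<Rightarrow> real"
  assumes B: "filtration m B" and u: "\<And>a. shifts B (u a)"
    and w: "\<And>a. w a \<in> polynomial_functions V"
    and dist: "(\<lambda>x. (\<Sum>a\<in>UNIV. (w a x - u a x)\<^sup>2) - c) \<in> Q"
  shows "\<exists>B'. filtration (m + (CARD('d) - 1)) B' \<and> (\<forall>f. shifts B f \<longrightarrow> shifts B' f) \<and>
    (\<forall>a. shifts B' (w a))"
proof -
  define y where "y a = (\<lambda>x. w a x - u a x)" for a
  have u_poly: "u a \<in> polynomial_functions V" for a using u by (auto simp: shifts_def shift_by_def)
  have y_poly: "y a \<in> polynomial_functions V" for a
    unfolding y_def by (intro polynomial_functions_diff w u_poly)
  fix a0 :: 'd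
  obtain B1 where B1: "filtration (m + (CARD('d) - 1)) B1" "\<forall>f. shifts B f \<longrightarrow> shifts B1 f"
    "\<forall>a\<in>UNIV - {a0}. shifts B1 (y a)"
    using adjoin_variables[OF _ B, of "UNIV - {a0}" y] y_poly by auto
  define h where "h = (\<lambda>x. c + (-1) * (\<Sum>a\<in>UNIV - {a0}. y a x * y a x))"
  have "shifts B1 h"
    unfolding h_def
    by (rule shifts_add[OF B1(1) shifts_const[OF B1(1)] shifts_mult[OF shifts_const[OF B1(1)]]],
        rule shifts_sum[OF B1(1)], rule shifts_mult) (use B1(3) in auto)
  moreover have "(\<lambda>x. y a0 x * y a0 x - h x) \<in> Q"
  proof -
    have "y a0 x * y a0 x - h x = (\<Sum>a\<in>UNIV. (w a x - u a x)\<^sup>2) - c" for x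
      by (subst sum.remove[of _ a0]) (auto simp: h_def y_def power2_eq_square)
    then show ?thesis using dist by simp
  qed
  ultimately obtain B2 where B2: "filtration (m + (CARD('d) - 1)) B2"
    "\<forall>f. shifts B1 f \<longrightarrow> shifts B2 f" "shifts B2 (y a0)"
    using adjoin_square_root[OF B1(1) y_poly[of a0]] by blast
  have "shifts B2 (w a)" for a
  proof -
    have "shifts B2 (y a)" using B1(3) B2(2,3) by (cases "a = a0") auto
    moreover have "shifts B2 (u a)" using u B1(2) B2(2) by auto
    ultimately have "shifts B2 (\<lambda>x. y a x + u a x)" by (rule shifts_add[OF B2(1)])
    then show ?thesis by (simp add: y_def)
  qed
  then show ?thesis using B1(2) B2 by blast
qed

text \<open>Starting with the point \<open>0\<close>, the points are added one at a time, each at a known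
  distance from one of those already placed: the next point comes from the cut between the
  placed and the remaining points.\<close>

lemma filtration_of_cut_distances:
  fixes S :: "(nat \<Rightarrow> real ^ 'd :: finite) set"
  assumes prime: "prime_function_ideal ({..<n} \<times> UNIV) Q"
    and vanish: "\<And>f. f \<in> polynomial_functions ({..<n} \<times> UNIV) \<Longrightarrow>
      (\<And>x. x \<in> cloud_coords n ` S \<Longrightarrow> f x = 0) \<Longrightarrow> f \<in> Q"
    and L: "finite L"
    and cut: "\<And>P A. P \<in> S \<Longrightarrow> A \<subseteq> {..<n} \<Longrightarrow> A \<noteq> {} \<Longrightarrow> A \<noteq> {..<n} \<Longrightarrow>
      \<exists>i\<in>A. \<exists>j\<in>{..<n} - A. norm (P i - P j) \<in> L"
  shows "\<exists>B. prime_function_ideal.filtration ({..<n} \<times> UNIV) (n * CARD('d) + 1 - n) B \<and>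
    (\<forall>v\<in>{..<n} \<times> UNIV. prime_function_ideal.shifts ({..<n} \<times> UNIV) Q B (\<lambda>x. x v))"
proof (cases "n = 0")
  case True
  interpret prime_function_ideal "{..<n} \<times> UNIV" Q by fact
  show ?thesis using filtration_trivial True by auto
next
  case False
  interpret prime_function_ideal "{..<n} \<times> UNIV" Q by fact
  have "\<exists>A B. A \<subseteq> {..<n} \<and> card A = Suc s \<and> filtration (CARD('d) + s * (CARD('d) - 1)) B \<and>
      (\<forall>i\<in>A. \<forall>a. shifts B (\<lambda>x. x (i, a)))" if "Suc s \<le> n" for s
    using that
  proof (induction s)
    case 0
    have "(\<lambda>x. x (0, a)) \<in> polynomial_functions ({..<n} \<times> UNIV)" for a :: 'd
      using False by (intro polynomial_functions.coord) auto
    then obtain B where "filtration (0 + CARD('d)) B" "\<forall>a::'d. shifts B (\<lambda>x. x (0, a))"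
      using adjoin_variables[OF finite_class.finite_UNIV filtration_trivial, of "\<lambda>a x. x (0, a)" 0] by auto
    then show ?case using False by (intro exI[of _ "{0}"] exI[of _ B]) auto
  next
    case (Suc s)
    then obtain A B where A: "A \<subseteq> {..<n}" "card A = Suc s"
      and B: "filtration (CARD('d) + s * (CARD('d) - 1)) B" "\<forall>i\<in>A. \<forall>a. shifts B (\<lambda>x. x (i, a))"
      by auto
    have "A \<noteq> {}" "A \<noteq> {..<n}" using A Suc.prems by auto
    from cut_crossed_modulo_prime[OF prime vanish L cut[OF _ A(1) this] A(1)]
    obtain i j l where ij: "i \<in> A" "j \<in> {..<n} - A"
      and l: "(\<lambda>x. (\<Sum>a\<in>UNIV. (x (j, a) - x (i, a))\<^sup>2) - l\<^sup>2) \<in> Q" by blast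
    have coord: "(\<lambda>x. x (j, a)) \<in> polynomial_functions ({..<n} \<times> UNIV)" for a :: 'd
      using ij by (intro polynomial_functions.coord) auto
    obtain B' where B': "filtration (CARD('d) + s * (CARD('d) - 1) + (CARD('d) - 1)) B'"
      "\<forall>f. shifts B f \<longrightarrow> shifts B' f" "\<forall>a. shifts B' (\<lambda>x. x (j, a))"
      using adjoin_point_at_distance[where u = "\<lambda>a x. x (i, a)" and w = "\<lambda>a x. x (j, a)",
          OF B(1) _ coord l] B(2) ij(1) by auto
    have "card (insert j A) = Suc (Suc s)"
      using ij(2) A by (simp add: card_insert_if finite_subset[OF A(1)])
    moreover have "filtration (CARD('d) + Suc s * (CARD('d) - 1)) B'"
      using B'(1) by (simp only: mult_Suc add_ac)
    ultimately show ?case using A ij B(2) B'(2,3) by (intro exI[of _ "insert j A"] exI[of _ B']) auto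
  qed
  from this[of "n - 1"] False obtain A B where A: "A \<subseteq> {..<n}" "card A = n"
    and B: "filtration (CARD('d) + (n - 1) * (CARD('d) - 1)) B" "\<forall>i\<in>A. \<forall>a. shifts B (\<lambda>x. x (i, a))"
    by auto
  have "A = {..<n}" using A by (intro card_subset_eq) auto
  moreover have "CARD('d) + (n - 1) * (CARD('d) - 1) = n * CARD('d) + 1 - n"
  proof -
    obtain e where "CARD('d) = Suc e" using not0_implies_Suc[of "CARD('d)"] by auto
    moreover obtain s where "n = Suc s" using False not0_implies_Suc by auto
    ultimately show ?thesis by (simp add: algebra_simps)
  qed
  ultimately show ?thesis using B by auto
qed

theorem cloud_dim_le_of_cut_distances:
  fixes S :: "(nat \<Rightarrow> real ^ 'd :: finite) set"
  assumes "finite L"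
    and "\<And>P A. P \<in> S \<Longrightarrow> A \<subseteq> {..<n} \<Longrightarrow> A \<noteq> {} \<Longrightarrow> A \<noteq> {..<n} \<Longrightarrow>
      \<exists>i\<in>A. \<exists>j\<in>{..<n} - A. norm (P i - P j) \<in> L"
  shows "cloud_dim n S \<le> ereal (real n * real CARD('d) - real n + 1)"
proof -
  have "cloud_dim n S \<le> ereal (real (n * CARD('d) + 1 - n))"
    unfolding cloud_dim_def semialgebraic_dim_def
  proof (rule krull_dim_coordinate_ring_le)
    fix Q :: "((nat \<times> 'd \<Rightarrow> real) \<Rightarrow> real) set"
    assume Q: "prime_function_ideal ({..<n} \<times> UNIV) Q"
      "\<And>f. f \<in> polynomial_functions ({..<n} \<times> UNIV) \<Longrightarrow>
        (\<And>x. x \<in> cloud_coords n ` S \<Longrightarrow> f x = 0) \<Longrightarrow> f \<in> Q"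
    show "\<exists>B. prime_function_ideal.filtration ({..<n} \<times> UNIV) (n * CARD('d) + 1 - n) B \<and>
        (\<forall>v\<in>{..<n} \<times> UNIV. prime_function_ideal.shifts ({..<n} \<times> UNIV) Q B (\<lambda>x. x v))"
      by (rule filtration_of_cut_distances[OF Q(1) _ assms]) (rule Q(2))
  qed
  moreover have "n \<le> n * CARD('d) + 1" using zero_less_card_finite[where 'a = 'd]
    by (metis Suc_leI add.commute le_add2 le_trans mult.right_neutral mult_le_mono2 One_nat_def)
  ultimately show ?thesis by (simp add: of_nat_diff algebra_simps)
qed

section \<open>Homology classes of a filtration\<close>

lemma finite_cofaces:
  assumes "c \<in> chains K i"
  shows "finite {v. v \<notin> \<tau> \<and> c (insert v \<tau>) \<noteq> 0}"
proof -
  have "finite ((\<lambda>v. insert v \<tau>) ` {v. v \<notin> \<tau> \<and> c (insert v \<tau>) \<noteq> 0})"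
    by (rule finite_subset[of _ "{\<sigma>. c \<sigma> \<noteq> 0}"]) (use assms in \<open>auto simp: chains_def\<close>)
  then show ?thesis by (rule finite_imageD) (auto simp: inj_on_def)
qed

lemma boundary_eq_sum:
  assumes "finite U" "{v. v \<notin> \<tau> \<and> c (insert v \<tau>) \<noteq> 0} \<subseteq> U" "\<tau> \<noteq> {}"
  shows "boundary c \<tau> = (\<Sum>v\<in>U - \<tau>. (-1) ^ card {u \<in> \<tau>. u < v} * c (insert v \<tau>))"
  unfolding boundary_def if_not_P[OF assms(3)]
  by (rule sum.mono_neutral_left) (use assms in auto)

lemma chains_lincomb:
  fixes c d :: "nat set \<Rightarrow> 'k :: field"
  assumes "c \<in> chains K i" "d \<in> chains K i"
  shows "(\<lambda>\<sigma>. a * c \<sigma> + b * d \<sigma>) \<in> chains K i"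
proof -
  have "{\<sigma>. a * c \<sigma> + b * d \<sigma> \<noteq> 0} \<subseteq> {\<sigma>. c \<sigma> \<noteq> 0} \<union> {\<sigma>. d \<sigma> \<noteq> 0}" by auto
  then have "finite {\<sigma>. a * c \<sigma> + b * d \<sigma> \<noteq> 0}"
    by (rule finite_subset) (use assms in \<open>simp add: chains_def\<close>)
  moreover have "c \<sigma> \<noteq> 0 \<or> d \<sigma> \<noteq> 0" if "a * c \<sigma> + b * d \<sigma> \<noteq> 0" for \<sigma>
    using that by auto
  ultimately show ?thesis using assms unfolding chains_def by blast
qed

lemma boundary_lincomb:
  fixes c d :: "nat set \<Rightarrow> 'k :: field"
  assumes c: "c \<in> chains K i" and d: "d \<in> chains K i"
  shows "boundary (\<lambda>\<sigma>. a * c \<sigma> + b * d \<sigma>) = (\<lambda>\<tau>. a * boundary c \<tau> + b * boundary d \<tau>)"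
proof
  fix \<tau>
  let ?U = "{v. v \<notin> \<tau> \<and> c (insert v \<tau>) \<noteq> 0} \<union> {v. v \<notin> \<tau> \<and> d (insert v \<tau>) \<noteq> 0}"
  have U: "finite ?U" using finite_cofaces[OF c] finite_cofaces[OF d] by auto
  show "boundary (\<lambda>\<sigma>. a * c \<sigma> + b * d \<sigma>) \<tau> = a * boundary c \<tau> + b * boundary d \<tau>"
  proof (cases "\<tau> = {}")
    case False
    have "boundary (\<lambda>\<sigma>. a * c \<sigma> + b * d \<sigma>) \<tau> =
        (\<Sum>v\<in>?U - \<tau>. (-1) ^ card {u \<in> \<tau>. u < v} * (a * c (insert v \<tau>) + b * d (insert v \<tau>)))"
      by (rule boundary_eq_sum[OF U _ False]) auto
    also have "\<dots> = a * (\<Sum>v\<in>?U - \<tau>. (-1) ^ card {u \<in> \<tau>. u < v} * c (insert v \<tau>)) +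
        b * (\<Sum>v\<in>?U - \<tau>. (-1) ^ card {u \<in> \<tau>. u < v} * d (insert v \<tau>))"
      by (simp add: sum_distrib_left algebra_simps sum.distrib)
    also have "(\<Sum>v\<in>?U - \<tau>. (-1) ^ card {u \<in> \<tau>. u < v} * c (insert v \<tau>)) = boundary c \<tau>"
      by (rule boundary_eq_sum[symmetric, OF U _ False]) auto
    also have "(\<Sum>v\<in>?U - \<tau>. (-1) ^ card {u \<in> \<tau>. u < v} * d (insert v \<tau>)) = boundary d \<tau>"
      by (rule boundary_eq_sum[symmetric, OF U _ False]) auto
    finally show ?thesis .
  qed (simp add: boundary_def)
qed

lemma boundaries_lincomb:
  fixes x y :: "nat set \<Rightarrow> 'k :: field"
  assumes "x \<in> boundaries K i" "y \<in> boundaries K i"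
  shows "(\<lambda>\<sigma>. a * x \<sigma> + b * y \<sigma>) \<in> boundaries K i"
proof -
  from assms obtain c d where cd: "c \<in> chains K (Suc i)" "x = boundary c"
    "d \<in> chains K (Suc i)" "y = boundary d" by (auto simp: boundaries_def)
  show ?thesis unfolding boundaries_def
    by (rule image_eqI[of _ _ "\<lambda>\<sigma>. a * c \<sigma> + b * d \<sigma>"])
      (use cd in \<open>simp_all add: boundary_lincomb chains_lincomb\<close>)
qed

lemma zero_chain: "(\<lambda>_. 0) \<in> chains K i"
  by (simp add: chains_def)

lemma boundary_zero: "boundary (\<lambda>_. 0) = (\<lambda>_. 0)"
  by (auto simp: boundary_def)

lemma zero_cycle: "(\<lambda>_. 0) \<in> cycles K i"
  by (simp add: cycles_def zero_chain boundary_zero)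

lemma zero_boundary: "(\<lambda>_. 0 :: 'k :: field) \<in> boundaries K i"
  unfolding boundaries_def
  by (rule image_eqI[of _ _ "\<lambda>_. 0"]) (simp_all only: boundary_zero zero_chain)

lemma cycles_lincomb:
  fixes c d :: "nat set \<Rightarrow> 'k :: field"
  assumes "c \<in> cycles K i" "d \<in> cycles K i"
  shows "(\<lambda>\<sigma>. a * c \<sigma> + b * d \<sigma>) \<in> cycles K i"
proof -
  from assms have "c \<in> chains K i" "d \<in> chains K i" "boundary c = (\<lambda>_. 0)" "boundary d = (\<lambda>_. 0)"
    by (auto simp: cycles_def)
  then show ?thesis using boundary_lincomb[of c K i d a b] by (simp add: cycles_def chains_lincomb)
qed

lemma mem_homology_class_iff:
  fixes z w :: "nat set \<Rightarrow> 'k :: field"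
  shows "w \<in> homology_class K i z \<longleftrightarrow> (\<lambda>\<sigma>. w \<sigma> - z \<sigma>) \<in> boundaries K i"
proof
  assume "(\<lambda>\<sigma>. w \<sigma> - z \<sigma>) \<in> boundaries K i"
  then show "w \<in> homology_class K i z"
    unfolding homology_class_def by (rule rev_image_eqI) auto
qed (auto simp: homology_class_def)

lemma homology_class_eq_iff:
  fixes z w :: "nat set \<Rightarrow> 'k :: field"
  shows "homology_class K i z = homology_class K i w \<longleftrightarrow> (\<lambda>\<sigma>. z \<sigma> - w \<sigma>) \<in> boundaries K i"
proof
  assume "homology_class K i z = homology_class K i w"
  moreover have "z \<in> homology_class K i z" by (simp add: mem_homology_class_iff zero_boundary)
  ultimately show "(\<lambda>\<sigma>. z \<sigma> - w \<sigma>) \<in> boundaries K i" by (simp add: mem_homology_class_iff)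
next
  assume zw: "(\<lambda>\<sigma>. z \<sigma> - w \<sigma>) \<in> boundaries K i"
  have "(\<lambda>\<sigma>. u \<sigma> - z \<sigma>) \<in> boundaries K i \<longleftrightarrow> (\<lambda>\<sigma>. u \<sigma> - w \<sigma>) \<in> boundaries K i" for u
    using boundaries_lincomb[OF _ zw, of "\<lambda>\<sigma>. u \<sigma> - z \<sigma>" 1 1]
      boundaries_lincomb[OF _ zw, of "\<lambda>\<sigma>. u \<sigma> - w \<sigma>" 1 "-1"] by auto
  then show "homology_class K i z = homology_class K i w"
    by (auto simp: mem_homology_class_iff)
qed

lemma self_mem_homology_class: "(z :: nat set \<Rightarrow> 'k :: field) \<in> homology_class K i z"
  by (simp add: mem_homology_class_iff zero_boundary)

lemma UN_eq_constI:
  assumes "a \<in> A" "\<And>x. x \<in> A \<Longrightarrow> f x = C"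
  shows "(\<Union>x\<in>A. f x) = C"
  using assms by auto

lemma homology_module_add:
  fixes z w :: "nat set \<Rightarrow> 'k :: field"
  shows "pm_add (homology_module X i) t (homology_class (X t) i z) (homology_class (X t) i w) =
    homology_class (X t) i (\<lambda>\<sigma>. z \<sigma> + w \<sigma>)"
proof -
  have "homology_class (X t) i (\<lambda>\<sigma>. x \<sigma> + y \<sigma>) = homology_class (X t) i (\<lambda>\<sigma>. z \<sigma> + w \<sigma>)"
    if "x \<in> homology_class (X t) i z" "y \<in> homology_class (X t) i w" for x y
    using boundaries_lincomb[of "\<lambda>\<sigma>. x \<sigma> - z \<sigma>" "X t" i "\<lambda>\<sigma>. y \<sigma> - w \<sigma>" 1 1] that
    by (simp add: mem_homology_class_iff homology_class_eq_iff algebra_simps)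
  then show ?thesis
    unfolding homology_module_def persistence_module.simps
    by (intro UN_eq_constI[OF self_mem_homology_class])
qed

lemma homology_module_scale:
  fixes z :: "nat set \<Rightarrow> 'k :: field"
  shows "pm_scale (homology_module X i) t a (homology_class (X t) i z) =
    homology_class (X t) i (\<lambda>\<sigma>. a * z \<sigma>)"
proof -
  have "homology_class (X t) i (\<lambda>\<sigma>. a * x \<sigma>) = homology_class (X t) i (\<lambda>\<sigma>. a * z \<sigma>)"
    if "x \<in> homology_class (X t) i z" for x
    using boundaries_lincomb[of "\<lambda>\<sigma>. x \<sigma> - z \<sigma>" "X t" i "\<lambda>\<sigma>. x \<sigma> - z \<sigma>" a 0] that
    by (simp add: mem_homology_class_iff homology_class_eq_iff algebra_simps)
  then show ?thesis
    unfolding homology_module_def persistence_module.simps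
    by (intro UN_eq_constI[OF self_mem_homology_class])
qed

lemma homology_module_map:
  fixes z :: "nat set \<Rightarrow> 'k :: field"
  assumes "X s \<subseteq> X t"
  shows "pm_map (homology_module X i) s t (homology_class (X s) i z) = homology_class (X t) i z"
proof -
  have "boundaries (X s) i \<subseteq> (boundaries (X t) i :: (nat set \<Rightarrow> 'k) set)"
    unfolding boundaries_def using assms by (intro image_mono) (auto simp: chains_def)
  then have "homology_class (X t) i x = homology_class (X t) i z"
    if "x \<in> homology_class (X s) i z" for x
    using that by (auto simp: mem_homology_class_iff homology_class_eq_iff)
  then show ?thesis
    unfolding homology_module_def persistence_module.simps
    by (intro UN_eq_constI[OF self_mem_homology_class])
qed

definition bars :: "real set multiset \<Rightarrow> (real set \<times> nat) set" where
  "bars B = {(I, m). m < count B I}"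

text \<open>The carrier of \<open>barcode_module B\<close> at parameter \<open>t\<close>.\<close>

definition bar_vectors :: "real set multiset \<Rightarrow> real \<Rightarrow> (real set \<times> nat \<Rightarrow> 'k :: field) set" where
  "bar_vectors B t = (\<Pi>\<^sub>E j\<in>bars B. if t \<in> fst j then UNIV else {0})"

text \<open>Composing an interval decomposition with the passage from cycles to their classes
  gives linear maps onto the bar coordinates, with the boundaries as kernel. In this form no
  quotient spaces are left.\<close>

lemma interval_decomposition_on_cycles:
  fixes X :: "real \<Rightarrow> nat set set"
  assumes mono: "\<And>s t. s \<le> t \<Longrightarrow> X s \<subseteq> X t"
    and iso: "pm_isomorphic (homology_module X i :: ('k :: field, _) persistence_module) (barcode_module B)"
  obtains \<psi> :: "real \<Rightarrow> (nat set \<Rightarrow> 'k :: field) \<Rightarrow> real set \<times> nat \<Rightarrow> 'k"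
  where "\<And>t z. z \<in> cycles (X t) i \<Longrightarrow> \<psi> t z \<in> bar_vectors B t"
    and "\<And>t f. f \<in> bar_vectors B t \<Longrightarrow> \<exists>z\<in>cycles (X t) i. \<psi> t z = f"
    and "\<And>t z w a b j. z \<in> cycles (X t) i \<Longrightarrow> w \<in> cycles (X t) i \<Longrightarrow> j \<in> bars B \<Longrightarrow>
      \<psi> t (\<lambda>\<sigma>. a * z \<sigma> + b * w \<sigma>) j = a * \<psi> t z j + b * \<psi> t w j"
    and "\<And>t z. z \<in> cycles (X t) i \<Longrightarrow> (\<forall>j\<in>bars B. \<psi> t z j = 0) \<longleftrightarrow> z \<in> boundaries (X t) i"
    and "\<And>s t z j. s \<le> t \<Longrightarrow> z \<in> cycles (X s) i \<Longrightarrow> j \<in> bars B \<Longrightarrow>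
      \<psi> t z j = (if s \<in> fst j \<and> t \<in> fst j then \<psi> s z j else 0)"
proof -
  let ?H = "homology_module X i :: ('k, _) persistence_module"
  let ?N = "barcode_module B :: ('k, _) persistence_module"
  have space: "pm_space ?N t = bar_vectors B t" for t
    by (simp add: barcode_module_def pm_direct_sum_def bar_vectors_def bars_def interval_module_def
        case_prod_unfold)
  have add: "pm_add ?N t f g j = f j + g j" if "j \<in> bars B" for t f g j
    using that by (simp add: barcode_module_def pm_direct_sum_def bars_def interval_module_def
        case_prod_unfold)
  have scale: "pm_scale ?N t a f j = a * f j" if "j \<in> bars B" for t a f j
    using that by (simp add: barcode_module_def pm_direct_sum_def bars_def interval_module_def
        case_prod_unfold)
  have map: "pm_map ?N s t f j = (if s \<in> fst j \<and> t \<in> fst j then f j else 0)" if "j \<in> bars B" for s t f j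
    using that by (simp add: barcode_module_def pm_direct_sum_def bars_def interval_module_def
        case_prod_unfold)
  from iso obtain \<phi> where bij: "\<forall>t. bij_betw (\<phi> t) (pm_space ?H t) (pm_space ?N t)"
    and \<phi>_add': "\<forall>t. \<forall>x\<in>pm_space ?H t. \<forall>y\<in>pm_space ?H t.
      \<phi> t (pm_add ?H t x y) = pm_add ?N t (\<phi> t x) (\<phi> t y)"
    and \<phi>_scale': "\<forall>t. \<forall>a. \<forall>x\<in>pm_space ?H t. \<phi> t (pm_scale ?H t a x) = pm_scale ?N t a (\<phi> t x)"
    and \<phi>_map': "\<forall>s t. s \<le> t \<longrightarrow> (\<forall>x\<in>pm_space ?H s.
      \<phi> t (pm_map ?H s t x) = pm_map ?N s t (\<phi> s x))"
    unfolding pm_isomorphic_def by (elim exE conjE)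
  note \<phi>_add = \<phi>_add'[rule_format] and \<phi>_scale = \<phi>_scale'[rule_format]
    and \<phi>_map = \<phi>_map'[rule_format]
  have H: "pm_space ?H t = homology_class (X t) i ` cycles (X t) i" for t
    by (simp add: homology_module_def)
  have in_space: "homology_class (X t) i z \<in> pm_space ?H t" if "z \<in> cycles (X t) i" for t z
    using that by (simp add: H)
  define \<psi> where "\<psi> = (\<lambda>t z. \<phi> t (homology_class (X t) i z))"
  have mem: "\<psi> t z \<in> bar_vectors B t" if "z \<in> cycles (X t) i" for t z
    using bij[rule_format, of t] in_space[OF that] by (auto simp: \<psi>_def space bij_betw_def)
  have surj: "\<exists>z\<in>cycles (X t) i. \<psi> t z = f" if "f \<in> bar_vectors B t" for t f
  proof -
    have "f \<in> \<phi> t ` homology_class (X t) i ` cycles (X t) i"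
      using bij[rule_format, of t] that by (simp add: space bij_betw_def H)
    then show ?thesis by (auto simp: \<psi>_def)
  qed
  have lin: "\<psi> t (\<lambda>\<sigma>. a * z \<sigma> + b * w \<sigma>) j = a * \<psi> t z j + b * \<psi> t w j"
    if z: "z \<in> cycles (X t) i" and w: "w \<in> cycles (X t) i" and j: "j \<in> bars B" for t z w a b j
  proof -
    have multiple: "(\<lambda>\<sigma>. a * u \<sigma>) \<in> cycles (X t) i" if "u \<in> cycles (X t) i" for a u
      using cycles_lincomb[OF that that, of a 0] by simp
    let ?az = "\<lambda>\<sigma>. a * z \<sigma>" and ?bw = "\<lambda>\<sigma>. b * w \<sigma>"
    have scaled: "\<psi> t (\<lambda>\<sigma>. a * u \<sigma>) = pm_scale ?N t a (\<psi> t u)" if "u \<in> cycles (X t) i" for a u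
      using \<phi>_scale[OF in_space[OF that]] by (simp only: \<psi>_def homology_module_scale)
    have "\<psi> t (\<lambda>\<sigma>. a * z \<sigma> + b * w \<sigma>) = pm_add ?N t (\<psi> t ?az) (\<psi> t ?bw)"
      using \<phi>_add[OF in_space[OF multiple[OF z]] in_space[OF multiple[OF w]]]
      by (simp only: \<psi>_def homology_module_add)
    then show ?thesis by (simp add: scaled z w add scale j)
  qed
  have zero: "\<psi> t (\<lambda>_. 0) j = 0" if "j \<in> bars B" for t j
    using lin[OF zero_cycle zero_cycle that, of t 0 0] by simp
  have kernel: "(\<forall>j\<in>bars B. \<psi> t z j = 0) \<longleftrightarrow> z \<in> boundaries (X t) i" if z: "z \<in> cycles (X t) i" for t z
  proof -
    have "\<psi> t z = \<psi> t (\<lambda>_. 0)" if "\<forall>j\<in>bars B. \<psi> t z j = 0"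
      by (rule PiE_ext[OF mem[OF z, unfolded bar_vectors_def] mem[OF zero_cycle, unfolded bar_vectors_def]])
        (use that zero in simp)
    then have "(\<forall>j\<in>bars B. \<psi> t z j = 0) \<longleftrightarrow> \<psi> t z = \<psi> t (\<lambda>_. 0)"
      using zero by auto
    also have "\<dots> \<longleftrightarrow> homology_class (X t) i z = homology_class (X t) i (\<lambda>_. 0)"
      unfolding \<psi>_def using bij[rule_format, of t] in_space[OF z] in_space[OF zero_cycle]
      by (auto simp: bij_betw_def inj_on_def)
    finally show ?thesis by (simp add: homology_class_eq_iff)
  qed
  have nat: "\<psi> t z j = (if s \<in> fst j \<and> t \<in> fst j then \<psi> s z j else 0)"
    if "s \<le> t" "z \<in> cycles (X s) i" "j \<in> bars B" for s t z j
    using \<phi>_map[OF that(1) in_space[OF that(2)]] map[OF that(3), of s t "\<psi> s z"]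
    by (simp add: homology_module_map[where X = X, OF mono[OF that(1)]] \<psi>_def)
  show ?thesis by (rule that[of \<psi>]) (use mem surj lin kernel nat in blast)+
qed

section \<open>Degree-zero homology of a distance filtration\<close>

lemma cycles_0: "cycles K 0 = (chains K 0 :: (nat set \<Rightarrow> 'k :: field) set)"
proof -
  have "boundary c \<tau> = 0" if c: "c \<in> chains K 0" for c :: "nat set \<Rightarrow> 'k" and \<tau>
  proof (cases "\<tau> = {}")
    case False
    have "c (insert v \<tau>) = 0" if "v \<notin> \<tau>" for v
    proof (rule ccontr)
      assume "c (insert v \<tau>) \<noteq> 0"
      then have "card (insert v \<tau>) = 1" using c by (auto simp: chains_def)
      then show False using that False by (auto simp: card_1_singleton_iff)
    qed
    then have no_coface: "{v. v \<notin> \<tau> \<and> c (insert v \<tau>) \<noteq> 0} = {}" by auto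
    show ?thesis unfolding boundary_def no_coface by simp
  qed (simp add: boundary_def)
  then show ?thesis by (auto simp: cycles_def)
qed

text \<open>Degree-zero homology depends on vertices and edges only, and these are the same in the
  Vietoris--Rips and Cech filtrations of a cloud.\<close>

locale distance_filtration =
  fixes n :: nat and P :: "nat \<Rightarrow> 'e :: real_normed_vector" and X :: "real \<Rightarrow> nat set set"
  assumes filtration_mono: "s \<le> t \<Longrightarrow> X s \<subseteq> X t"
    and simplex_subset: "\<sigma> \<in> X t \<Longrightarrow> \<sigma> \<subseteq> {..<n}"
    and edge_iff: "i < n \<Longrightarrow> j < n \<Longrightarrow> {i, j} \<in> X t \<longleftrightarrow> norm (P i - P j) \<le> 2 * t"
    and inj_points: "inj_on P {..<n}"
begin

lemma zero_chains_iff: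
  fixes z :: "nat set \<Rightarrow> 'k :: field"
  assumes "0 \<le> t"
  shows "z \<in> chains (X t) 0 \<longleftrightarrow> (\<forall>\<sigma>. z \<sigma> \<noteq> 0 \<longrightarrow> (\<exists>i<n. \<sigma> = {i}))"
proof
  assume "z \<in> chains (X t) 0"
  then show "\<forall>\<sigma>. z \<sigma> \<noteq> 0 \<longrightarrow> (\<exists>i<n. \<sigma> = {i})"
    using simplex_subset by (fastforce simp: chains_def card_1_singleton_iff)
next
  assume z: "\<forall>\<sigma>. z \<sigma> \<noteq> 0 \<longrightarrow> (\<exists>i<n. \<sigma> = {i})"
  have "{i} \<in> X t" if "i < n" for i using edge_iff[OF that that, of t] assms by simp
  moreover have "finite {\<sigma>. z \<sigma> \<noteq> 0}"
    by (rule finite_subset[of _ "(\<lambda>i. {i}) ` {..<n}"]) (use z in auto)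
  ultimately show "z \<in> chains (X t) 0" using z by (fastforce simp: chains_def)
qed

lemma zero_chains_negative:
  assumes "t < 0" "z \<in> chains (X t) 0"
  shows "z = (\<lambda>_. 0)"
proof (rule ccontr)
  assume "z \<noteq> (\<lambda>_. 0)"
  then obtain \<sigma> where "z \<sigma> \<noteq> 0" by auto
  then obtain i where "{i} \<in> X t" using assms(2) by (fastforce simp: chains_def card_1_singleton_iff)
  moreover from this have "i < n" using simplex_subset by auto
  ultimately show False using edge_iff[of i i t] assms(1) by simp
qed

lemma one_chain_support:
  assumes "c \<in> chains (X t) 1" "c \<sigma> \<noteq> 0"
  obtains i j where "\<sigma> = {i, j}" "i \<noteq> j" "i < n" "j < n" "norm (P i - P j) \<le> 2 * t"
proof -
  have "\<sigma> \<in> X t" "card \<sigma> = 2" using assms by (auto simp: chains_def)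
  moreover from this obtain i j where "\<sigma> = {i, j}" "i \<noteq> j" by (auto simp: card_2_iff)
  moreover from calculation have "i < n" "j < n" using simplex_subset by auto
  ultimately show ?thesis using that edge_iff by blast
qed

lemma boundaries_at_0: "z \<in> boundaries (X 0) 0 \<Longrightarrow> z = (\<lambda>_. 0)"
proof -
  assume "z \<in> boundaries (X 0) 0"
  then obtain c where c: "c \<in> chains (X 0) 1" "z = boundary c" by (auto simp: boundaries_def)
  have "c \<sigma> = 0" for \<sigma>
  proof (rule ccontr)
    assume "c \<sigma> \<noteq> 0"
    with c(1) obtain i j where "i \<noteq> j" "i < n" "j < n" "norm (P i - P j) \<le> 2 * 0"
      by (rule one_chain_support)
    then show False using inj_points by (auto simp: inj_on_def)
  qed
  then have "c = (\<lambda>_. 0)" by auto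
  then show ?thesis using c(2) boundary_zero by simp
qed

text \<open>In the boundary of an edge the coefficients of the two endpoints cancel, and no edge
  joins the part \<open>A\<close> with its complement.\<close>

lemma boundary_sum_over_separated_part:
  fixes c :: "nat set \<Rightarrow> 'k :: field"
  assumes c: "c \<in> chains (X t) 1" and A: "A \<subseteq> {..<n}"
    and sep: "\<And>i j. i \<in> A \<Longrightarrow> j \<in> {..<n} - A \<Longrightarrow> \<not> norm (P i - P j) \<le> 2 * t"
  shows "(\<Sum>i\<in>A. boundary c {i}) = 0"
proof -
  have fin: "finite A" using A finite_subset by auto
  have vanish: "c {i, v} = 0" if "i \<in> A" "v \<notin> A" for i v
  proof (rule ccontr)
    assume "c {i, v} \<noteq> 0"
    with c obtain k l where "{i, v} = {k, l}" "k < n" "l < n" "norm (P k - P l) \<le> 2 * t"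
      by (rule one_chain_support)
    then have "v < n" "norm (P i - P v) \<le> 2 * t" by (auto simp: doubleton_eq_iff norm_minus_commute)
    then show False using sep[of i v] that by auto
  qed
  have "boundary c {i} = (\<Sum>v\<in>A. if v < i then c {i, v} else 0) - (\<Sum>v\<in>A. if i < v then c {i, v} else 0)"
    if i: "i \<in> A" for i
  proof -
    have "boundary c {i} = (\<Sum>v\<in>A - {i}. (-1) ^ card {u \<in> {i}. u < v} * c (insert v {i}))"
      by (rule boundary_eq_sum) (use fin vanish[OF i] in \<open>auto simp: insert_commute\<close>)
    also have "\<dots> = (\<Sum>v\<in>A - {i}. (if v < i then c {i, v} else 0) - (if i < v then c {i, v} else 0))"
    proof (rule sum.cong)
      fix v assume "v \<in> A - {i}"
      then have "{u \<in> {i}. u < v} = (if i < v then {i} else {})" and "v < i \<or> i < v" by auto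
      then show "(-1) ^ card {u \<in> {i}. u < v} * c (insert v {i}) =
          (if v < i then c {i, v} else 0) - (if i < v then c {i, v} else 0)"
        by (auto simp: insert_commute)
    qed simp
    also have "\<dots> = (\<Sum>v\<in>A. (if v < i then c {i, v} else 0) - (if i < v then c {i, v} else 0))"
      by (rule sum.mono_neutral_left) (use fin in auto)
    finally show ?thesis by (simp add: sum_subtractf)
  qed
  then have "(\<Sum>i\<in>A. boundary c {i}) =
      (\<Sum>i\<in>A. \<Sum>v\<in>A. if v < i then c {i, v} else 0) - (\<Sum>i\<in>A. \<Sum>v\<in>A. if i < v then c {i, v} else 0)"
    by (simp add: sum_subtractf)
  also have "(\<Sum>i\<in>A. \<Sum>v\<in>A. if v < i then c {i, v} else 0) = (\<Sum>i\<in>A. \<Sum>v\<in>A. if i < v then c {i, v} else 0)"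
    by (subst sum.swap, intro sum.cong refl) (auto simp: insert_commute)
  finally show ?thesis by simp
qed

definition vertex_difference :: "nat \<Rightarrow> nat \<Rightarrow> nat set \<Rightarrow> 'k :: field" where
  "vertex_difference i j \<sigma> = (if \<sigma> = {i} then 1 else if \<sigma> = {j} then -1 else 0)"

lemma vertex_difference_cycle:
  assumes "i < n" "j < n" "0 \<le> t"
  shows "vertex_difference i j \<in> cycles (X t) 0"
  unfolding cycles_0 zero_chains_iff[OF assms(3)]
  using assms by (auto simp: vertex_difference_def split: if_splits)

lemma vertex_difference_boundary:
  assumes ij: "i < n" "j < n" "i \<noteq> j" and "norm (P i - P j) \<le> 2 * t"
  shows "(vertex_difference i j :: nat set \<Rightarrow> 'k :: field) \<in> boundaries (X t) 0"
proof -
  \<comment> \<open>an edge is oriented from its smaller to its larger vertex, and its boundary is the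
    larger minus the smaller one\<close>
  define c :: "nat set \<Rightarrow> 'k" where "c \<sigma> = (if \<sigma> = {i, j} then (if i < j then -1 else 1) else 0)" for \<sigma>
  have "{i, j} \<in> X t" using edge_iff assms by auto
  moreover have "finite {\<sigma>. c \<sigma> \<noteq> 0}"
    by (rule finite_subset[of _ "{{i, j}}"]) (auto simp: c_def)
  moreover have "\<sigma> \<in> X t \<and> card \<sigma> = Suc 1" if "c \<sigma> \<noteq> 0" for \<sigma>
  proof -
    have "\<sigma> = {i, j}" using that by (simp add: c_def split: if_splits)
    then show ?thesis using \<open>{i, j} \<in> X t\<close> ij(3) by simp
  qed
  ultimately have c: "c \<in> chains (X t) 1"
    unfolding chains_def by blast
  have c_nonzero: "c \<sigma> \<noteq> 0 \<longleftrightarrow> \<sigma> = {i, j}" for \<sigma> by (simp add: c_def)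
  have cofaces: "v \<notin> \<tau> \<and> insert v \<tau> = {i, j} \<longleftrightarrow> \<tau> = {i} \<and> v = j \<or> \<tau> = {j} \<and> v = i" for v \<tau>
  proof
    assume v: "v \<notin> \<tau> \<and> insert v \<tau> = {i, j}"
    then have "\<tau> = {i, j} - {v}" by (simp add: Diff_insert_absorb flip: v[THEN conjunct2])
    moreover have "v = i \<or> v = j" using v insertI1[of v \<tau>] by simp
    ultimately show "\<tau> = {i} \<and> v = j \<or> \<tau> = {j} \<and> v = i" using ij(3) by auto
  qed (use ij(3) in \<open>elim disjE conjE; simp add: insert_commute\<close>)
  have sign: "{u. u = a \<and> u < b} = (if a < b then {a} else {})" for a b :: nat by auto
  have "boundary c \<tau> = vertex_difference i j \<tau>" for \<tau>
  proof -
    consider "\<tau> = {i}" | "\<tau> = {j}" | "\<tau> \<noteq> {i}" "\<tau> \<noteq> {j}" by blast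
    then show ?thesis
    proof cases
      case 1
      then have "{v. v \<notin> \<tau> \<and> c (insert v \<tau>) \<noteq> 0} = {j}"
        unfolding c_nonzero cofaces using ij(3) by simp
      then show ?thesis
        unfolding boundary_def using 1 by (simp add: sign vertex_difference_def c_def insert_commute)
    next
      case 2
      then have "{v. v \<notin> \<tau> \<and> c (insert v \<tau>) \<noteq> 0} = {i}"
        unfolding c_nonzero cofaces using ij(3) by simp
      then show ?thesis
        unfolding boundary_def using 2 ij(3) by (simp add: sign vertex_difference_def c_def)
    next
      case 3
      then have "{v. v \<notin> \<tau> \<and> c (insert v \<tau>) \<noteq> 0} = {}" unfolding c_nonzero cofaces by simp
      then show ?thesis unfolding boundary_def using 3 by (simp only: vertex_difference_def) simp
    qed
  qed
  then have "vertex_difference i j = boundary c" by auto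
  then show ?thesis using c by (auto simp: boundaries_def)
qed

lemma vertex_difference_not_boundary:
  assumes A: "A \<subseteq> {..<n}" and ij: "i \<in> A" "j \<notin> A"
    and sep: "\<And>i j. i \<in> A \<Longrightarrow> j \<in> {..<n} - A \<Longrightarrow> \<not> norm (P i - P j) \<le> 2 * t"
  shows "(vertex_difference i j :: nat set \<Rightarrow> 'k :: field) \<notin> boundaries (X t) 0"
proof
  assume "(vertex_difference i j :: nat set \<Rightarrow> 'k) \<in> boundaries (X t) 0"
  then obtain c :: "nat set \<Rightarrow> 'k" where c: "c \<in> chains (X t) 1" "vertex_difference i j = boundary c"
    by (auto simp: boundaries_def)
  have "(\<Sum>a\<in>A. vertex_difference i j {a} :: 'k) = (\<Sum>a\<in>A. if a = i then 1 else 0)"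
    by (rule sum.cong) (use ij in \<open>auto simp: vertex_difference_def\<close>)
  also have "\<dots> = 1" using ij(1) A finite_subset[OF A] by simp
  finally show False using boundary_sum_over_separated_part[OF c(1) A sep] c(2) by simp
qed

end

text \<open>For \<open>s\<close> above all right endpoints that are less than \<open>r\<close>, an interval that contains
  \<open>s\<close> and not \<open>r\<close> can only end at \<open>r\<close>.\<close>

lemma interval_ends_at:
  fixes r :: real
  assumes fin: "finite \<I>" and int: "\<And>I. I \<in> \<I> \<Longrightarrow> is_interval I" and r: "0 < r"
    and ends: "\<And>s. 0 \<le> s \<Longrightarrow> s < r \<Longrightarrow> \<exists>I\<in>\<I>. s \<in> I \<and> r \<notin> I"
  shows "\<exists>I\<in>\<I>. Sup I = r"
proof (rule ccontr)
  assume none: "\<not> ?thesis"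
  let ?E = "insert 0 {e \<in> Sup ` \<I>. e < r}"
  have E: "finite ?E" using fin by auto
  define s where "s = (Max ?E + r) / 2"
  have "Max ?E < r" "0 \<le> Max ?E" using E r by (auto simp del: Max_insert)
  then have s: "0 \<le> s" "s < r" "Max ?E < s" by (auto simp: s_def)
  from ends[OF s(1,2)] obtain I where I: "I \<in> \<I>" "s \<in> I" "r \<notin> I" by auto
  have less: "x < r" if "x \<in> I" for x
  proof (rule ccontr)
    assume "\<not> x < r"
    then have "r \<in> I" using mem_is_interval_1_I[OF int[OF I(1)] I(2) that] s(2) by simp
    then show False using I(3) by simp
  qed
  have "bdd_above I" using less by (auto intro!: bdd_aboveI[of _ r] less_imp_le)
  then have "s \<le> Sup I" using I(2) by (rule cSup_upper[rotated])
  moreover have "Sup I \<le> r" using I(2) less by (intro cSup_least) (auto intro: less_imp_le)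
  moreover have "Sup I \<noteq> r" using none I(1) by auto
  ultimately have "Sup I \<in> ?E" using I(1) by auto
  then have "Sup I \<le> Max ?E" using E by (rule Max_ge[rotated])
  then show False using \<open>s \<le> Sup I\<close> s(3) by simp
qed

lemma bars_Sigma: "bars B = (SIGMA I:set_mset B. {..<count B I})"
  by (auto simp: bars_def) (metis count_eq_zero_iff not_less_zero)

lemma finite_bars: "finite (bars B)"
  by (simp add: bars_Sigma)

lemma card_bars: "card (bars B) = size B"
  by (simp add: bars_Sigma size_multiset_overloaded_eq)

text \<open>The maps \<open>\<psi>\<close> are those of \<open>interval_decomposition_on_cycles\<close>.\<close>

locale degree_zero_decomposition = distance_filtration n P X
  for n :: nat and P :: "nat \<Rightarrow> 'e :: real_normed_vector" and X :: "real \<Rightarrow> nat set set" +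
  fixes B :: "real set multiset" and \<psi> :: "real \<Rightarrow> (nat set \<Rightarrow> 'k :: field) \<Rightarrow> real set \<times> nat \<Rightarrow> 'k"
  assumes bar_interval: "I \<in># B \<Longrightarrow> is_interval I"
    and bar_nonempty: "I \<in># B \<Longrightarrow> I \<noteq> {}"
    and \<psi>_mem: "z \<in> cycles (X t) 0 \<Longrightarrow> \<psi> t z \<in> bar_vectors B t"
    and \<psi>_surj: "f \<in> bar_vectors B t \<Longrightarrow> \<exists>z\<in>cycles (X t) 0. \<psi> t z = f"
    and \<psi>_lin: "z \<in> cycles (X t) 0 \<Longrightarrow> w \<in> cycles (X t) 0 \<Longrightarrow> j \<in> bars B \<Longrightarrow>
      \<psi> t (\<lambda>\<sigma>. a * z \<sigma> + b * w \<sigma>) j = a * \<psi> t z j + b * \<psi> t w j"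
    and \<psi>_kernel: "z \<in> cycles (X t) 0 \<Longrightarrow> (\<forall>j\<in>bars B. \<psi> t z j = 0) \<longleftrightarrow> z \<in> boundaries (X t) 0"
    and \<psi>_nat: "s \<le> t \<Longrightarrow> z \<in> cycles (X s) 0 \<Longrightarrow> j \<in> bars B \<Longrightarrow>
      \<psi> t z j = (if s \<in> fst j \<and> t \<in> fst j then \<psi> s z j else 0)"
begin

text \<open>When two sides of a cut first get connected, at parameter \<open>r\<close>, the difference of two
  vertices from different sides becomes a boundary. It was none before, so for every \<open>s < r\<close>
  some bar contains \<open>s\<close> and not \<open>r\<close>; as there are finitely many bars, one of them ends at
  \<open>r\<close>.\<close>

lemma crossing_distance_is_death_time:
  assumes A: "A \<subseteq> {..<n}" "A \<noteq> {}" "A \<noteq> {..<n}"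
  shows "\<exists>i\<in>A. \<exists>j\<in>{..<n} - A. norm (P i - P j) \<in> (\<lambda>I. 2 * Sup I) ` set_mset B"
proof -
  let ?d = "(\<lambda>(i, j). norm (P i - P j)) ` (A \<times> ({..<n} - A))"
  have d: "finite ?d" "?d \<noteq> {}" using A finite_subset[OF A(1)] by auto
  from Min_in[OF this] obtain i j where ij: "i \<in> A" "j \<in> {..<n} - A" "norm (P i - P j) = Min ?d"
    by auto
  define r where "r = Min ?d / 2"
  have ij': "i < n" "j < n" "i \<noteq> j" using ij A by auto
  have sep: "\<not> norm (P k - P l) \<le> 2 * s" if "s < r" "k \<in> A" "l \<in> {..<n} - A" for s k l
  proof -
    have "norm (P k - P l) \<in> ?d" by (rule image_eqI[of _ _ "(k, l)"]) (use that in auto)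
    from Min_le[OF d(1) this] that(1) show ?thesis by (simp only: r_def)
  qed
  have "0 < norm (P i - P j)" using ij' inj_points by (auto simp: inj_on_def)
  then have r: "0 < r" using ij(3) by (simp add: r_def)
  have "\<exists>I\<in>set_mset B. Sup I = r"
  proof (rule interval_ends_at)
    fix s assume s: "0 \<le> s" "s < r"
    let ?z = "vertex_difference i j :: nat set \<Rightarrow> 'k"
    have cycle: "?z \<in> cycles (X t) 0" if "0 \<le> t" for t
      using vertex_difference_cycle ij' that by blast
    have "?z \<notin> boundaries (X s) 0"
      using ij sep[OF s(2)] by (intro vertex_difference_not_boundary[OF A(1)]) auto
    then obtain k where k: "k \<in> bars B" "\<psi> s ?z k \<noteq> 0" using \<psi>_kernel[OF cycle[OF s(1)]] by auto
    have "?z \<in> boundaries (X r) 0"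
      using ij' ij(3) by (intro vertex_difference_boundary) (auto simp: r_def)
    then have "\<psi> r ?z k = 0" using \<psi>_kernel[of ?z r] cycle[of r] r k(1) by auto
    then have "\<not> (s \<in> fst k \<and> r \<in> fst k)"
      using \<psi>_nat[of s r ?z k] cycle[OF s(1)] s(2) k by auto
    moreover have "s \<in> fst k"
      using PiE_mem[OF \<psi>_mem[OF cycle[OF s(1)], unfolded bar_vectors_def] k(1)] k(2)
      by (auto split: if_splits)
    moreover have "fst k \<in> set_mset B" using k(1) by (auto simp: bars_Sigma)
    ultimately show "\<exists>I\<in>set_mset B. s \<in> I \<and> r \<notin> I" by blast
  qed (use bar_interval r in auto)
  then obtain I where "I \<in> set_mset B" "norm (P i - P j) = 2 * Sup I"
    using ij(3) by (auto simp: r_def)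
  then have "norm (P i - P j) \<in> (\<lambda>I. 2 * Sup I) ` set_mset B" by blast
  then show ?thesis using ij by blast
qed

definition unit_vector :: "real set \<times> nat \<Rightarrow> real set \<times> nat \<Rightarrow> 'k" where
  "unit_vector k = (\<lambda>j\<in>bars B. if j = k then 1 else 0)"

lemma unit_vector_mem: "k \<in> bars B \<Longrightarrow> t \<in> fst k \<Longrightarrow> unit_vector k \<in> bar_vectors B t"
  by (auto simp: unit_vector_def bar_vectors_def)

text \<open>The vertices are all present at parameter \<open>0\<close>, so every class at \<open>t \<ge> 0\<close> is the image
  of one at \<open>0\<close>, whereas a bar that misses \<open>0\<close> has coordinate zero on all such images. For
  \<open>t < 0\<close> there is no homology.\<close>

lemma bars_contain_0:
  assumes k: "k \<in> bars B"
  shows "0 \<in> fst k"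
proof -
  have "fst k \<in># B" using k by (auto simp: bars_Sigma)
  then obtain t where t: "t \<in> fst k" using bar_nonempty by blast
  then obtain z where z: "z \<in> cycles (X t) 0" "\<psi> t z = unit_vector k"
    using \<psi>_surj unit_vector_mem[OF k] by blast
  have nonzero: "\<psi> t z k \<noteq> 0" using k z(2) by (simp add: unit_vector_def)
  have t0: "0 \<le> t"
  proof (rule ccontr)
    assume "\<not> 0 \<le> t"
    then have "z = (\<lambda>_. 0)" using zero_chains_negative[of t z] z(1) by (simp add: cycles_0)
    then show False using \<psi>_kernel[OF z(1)] zero_boundary nonzero k by auto
  qed
  then have "z \<in> cycles (X 0) 0" using z(1) by (simp add: cycles_0 zero_chains_iff)
  from \<psi>_nat[OF t0 this k] nonzero show ?thesis by (auto split: if_splits)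
qed

lemma \<psi>_sum:
  assumes "finite A" "\<And>a. a \<in> A \<Longrightarrow> z a \<in> cycles (X t) 0"
  shows "(\<lambda>\<sigma>. \<Sum>a\<in>A. c a * z a \<sigma>) \<in> cycles (X t) 0 \<and>
    (\<forall>j\<in>bars B. \<psi> t (\<lambda>\<sigma>. \<Sum>a\<in>A. c a * z a \<sigma>) j = (\<Sum>a\<in>A. c a * \<psi> t (z a) j))"
  using assms
proof (induction A rule: finite_induct)
  case empty
  then show ?case using \<psi>_lin[OF zero_cycle zero_cycle, of _ t 0 0] by (simp add: zero_cycle)
next
  case (insert a A)
  let ?w = "\<lambda>\<sigma>. \<Sum>a\<in>A. c a * z a \<sigma>"
  have "z a \<in> cycles (X t) 0" "?w \<in> cycles (X t) 0" using insert by auto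
  then show ?case
    using cycles_lincomb[of "z a" "X t" 0 ?w "c a" 1] \<psi>_lin[of "z a" t ?w _ "c a" 1] insert by simp
qed

text \<open>All bars contain \<open>0\<close>, and at parameter \<open>0\<close> there are no edges, so \<open>\<psi> 0\<close> is an
  isomorphism from the free space on the \<open>n\<close> vertices onto the space with one coordinate for
  each bar.\<close>

lemma number_of_bars: "size B = n"
proof (rule antisym; rule leI; rule notI)
  \<comment> \<open>a relation between the images of the vertices contradicts injectivity\<close>
  assume "size B < n"
  define e :: "nat \<Rightarrow> nat set \<Rightarrow> 'k" where "e i \<sigma> = (if \<sigma> = {i} then 1 else 0)" for i \<sigma>
  have e: "e i \<in> cycles (X 0) 0" if "i \<in> {..<n}" for i
    using that by (auto simp: cycles_0 zero_chains_iff e_def)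
  have "card (bars B) < card {..<n}" using \<open>size B < n\<close> by (simp add: card_bars)
  from underdetermined_system_has_solution[OF finite_bars finite_lessThan this, of "\<lambda>i. \<psi> 0 (e i)"]
  obtain c i where i: "i < n" "c i \<noteq> 0" and c: "\<forall>j\<in>bars B. (\<Sum>i<n. c i * \<psi> 0 (e i) j) = 0" by auto
  have "(\<lambda>\<sigma>. \<Sum>i<n. c i * e i \<sigma>) \<in> boundaries (X 0) 0"
    using \<psi>_sum[OF finite_lessThan e, where c = c] c \<psi>_kernel[of "\<lambda>\<sigma>. \<Sum>i<n. c i * e i \<sigma>" 0] by auto
  then have "(\<lambda>\<sigma>. \<Sum>i<n. c i * e i \<sigma>) = (\<lambda>_. 0)" by (rule boundaries_at_0)
  from fun_cong[OF this, of "{i}"] have "(\<Sum>k<n. c k * e k {i}) = 0" .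
  moreover have "(\<Sum>k<n. c k * e k {i}) = (\<Sum>k<n. if k = i then c k else 0)"
    by (rule sum.cong) (auto simp: e_def)
  ultimately show False using i by simp
next
  \<comment> \<open>a relation between preimages of the unit vectors contradicts their independence\<close>
  assume "n < size B"
  have "\<forall>k\<in>bars B. \<exists>z. z \<in> cycles (X 0) 0 \<and> \<psi> 0 z = unit_vector k"
    using \<psi>_surj unit_vector_mem bars_contain_0 by blast
  from bchoice[OF this] obtain z where z: "\<And>k. k \<in> bars B \<Longrightarrow> z k \<in> cycles (X 0) 0"
    "\<And>k. k \<in> bars B \<Longrightarrow> \<psi> 0 (z k) = unit_vector k" by blast
  have "card {..<n} < card (bars B)" using \<open>n < size B\<close> by (simp add: card_bars)
  from underdetermined_system_has_solution[OF finite_lessThan finite_bars this, of "\<lambda>k i. z k {i}"]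
  obtain c k where k: "k \<in> bars B" "c k \<noteq> 0" and c: "\<forall>i\<in>{..<n}. (\<Sum>k\<in>bars B. c k * z k {i}) = 0" by auto
  let ?w = "\<lambda>\<sigma>. \<Sum>k\<in>bars B. c k * z k \<sigma>"
  note w = \<psi>_sum[where A = "bars B" and z = z and t = 0 and c = c, OF finite_bars z(1)]
  have "?w \<sigma> = 0" for \<sigma>
  proof (rule ccontr)
    assume "?w \<sigma> \<noteq> 0"
    then obtain i where "i < n" "\<sigma> = {i}" using w by (auto simp: cycles_0 zero_chains_iff)
    then show False using c \<open>?w \<sigma> \<noteq> 0\<close> by auto
  qed
  then have "?w \<in> boundaries (X 0) 0" using zero_boundary by simp
  then have "\<psi> 0 ?w k = 0" using \<psi>_kernel[of ?w 0] w k(1) by auto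
  moreover have "\<psi> 0 ?w k = (\<Sum>j\<in>bars B. c j * unit_vector j k)" using w k(1) z(2) by simp
  moreover have "(\<Sum>j\<in>bars B. c j * unit_vector j k) = (\<Sum>j\<in>bars B. if j = k then c j else 0)"
    by (rule sum.cong) (use k(1) in \<open>auto simp: unit_vector_def\<close>)
  ultimately show False using k finite_bars by simp
qed

end

lemma (in distance_filtration) degree_zero_barcode:
  fixes F :: "'k :: field itself"
  assumes "persistent_homology_is F X D"
  shows "size (D 0) = n"
    and "A \<subseteq> {..<n} \<Longrightarrow> A \<noteq> {} \<Longrightarrow> A \<noteq> {..<n} \<Longrightarrow>
      \<exists>i\<in>A. \<exists>j\<in>{..<n} - A. norm (P i - P j) \<in> (\<lambda>I. 2 * Sup I) ` set_mset (D 0)"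
proof -
  from assms have bars: "barcode (D 0)"
    and iso: "pm_isomorphic (homology_module X 0 :: ('k, _) persistence_module) (barcode_module (D 0))"
    by (auto simp: persistent_homology_is_def full_barcode_def)
  obtain \<psi> :: "real \<Rightarrow> (nat set \<Rightarrow> 'k) \<Rightarrow> real set \<times> nat \<Rightarrow> 'k"
    where "degree_zero_decomposition n P X (D 0) \<psi>"
  proof (rule interval_decomposition_on_cycles[where X = X, OF filtration_mono iso])
    fix \<psi> :: "real \<Rightarrow> (nat set \<Rightarrow> 'k) \<Rightarrow> real set \<times> nat \<Rightarrow> 'k"
    assume 1: "\<And>t z. z \<in> cycles (X t) 0 \<Longrightarrow> \<psi> t z \<in> bar_vectors (D 0) t"
      and 2: "\<And>t f. f \<in> bar_vectors (D 0) t \<Longrightarrow> \<exists>z\<in>cycles (X t) 0. \<psi> t z = f"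
      and 3: "\<And>t z w a b j. z \<in> cycles (X t) 0 \<Longrightarrow> w \<in> cycles (X t) 0 \<Longrightarrow> j \<in> bars (D 0) \<Longrightarrow>
        \<psi> t (\<lambda>\<sigma>. a * z \<sigma> + b * w \<sigma>) j = a * \<psi> t z j + b * \<psi> t w j"
      and 4: "\<And>t z. z \<in> cycles (X t) 0 \<Longrightarrow>
        (\<forall>j\<in>bars (D 0). \<psi> t z j = 0) \<longleftrightarrow> z \<in> boundaries (X t) 0"
      and 5: "\<And>s t z j. s \<le> t \<Longrightarrow> z \<in> cycles (X s) 0 \<Longrightarrow> j \<in> bars (D 0) \<Longrightarrow>
        \<psi> t z j = (if s \<in> fst j \<and> t \<in> fst j then \<psi> s z j else 0)"
    have "degree_zero_decomposition n P X (D 0) \<psi>"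
    proof
      show "is_interval I" if "I \<in># D 0" for I using bars that by (simp add: barcode_def)
      show "I \<noteq> {}" if "I \<in># D 0" for I using bars that by (simp add: barcode_def)
    qed (fact 1 2 3 4 5)+
    then show thesis by (rule that)
  qed
  then interpret degree_zero_decomposition n P X "D 0" \<psi> .
  show "size (D 0) = n" by (rule number_of_bars)
  show "A \<subseteq> {..<n} \<Longrightarrow> A \<noteq> {} \<Longrightarrow> A \<noteq> {..<n} \<Longrightarrow>
      \<exists>i\<in>A. \<exists>j\<in>{..<n} - A. norm (P i - P j) \<in> (\<lambda>I. 2 * Sup I) ` set_mset (D 0)"
    by (rule crossing_distance_is_death_time)
qed

lemma distance_filtration_vietoris_rips:
  fixes P :: "nat \<Rightarrow> real ^ 'd :: finite"
  assumes "inj_on P {..<n}"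
  shows "distance_filtration n P (vietoris_rips n P)"
proof
  fix i j t assume "i < n" "j < n"
  moreover have "0 \<le> t" if "norm (P i - P j) \<le> 2 * t"
    using norm_ge_zero[of "P i - P j"] that by linarith
  ultimately show "{i, j} \<in> vietoris_rips n P t \<longleftrightarrow> norm (P i - P j) \<le> 2 * t"
    by (auto simp: vietoris_rips_def norm_minus_commute)
qed (use assms in \<open>force simp: vietoris_rips_def\<close>)+

text \<open>Two closed balls of radius \<open>t\<close> meet if and only if both contain the midpoint of the
  centers.\<close>

lemma distance_filtration_cech:
  fixes P :: "nat \<Rightarrow> real ^ 'd :: finite"
  assumes "inj_on P {..<n}"
  shows "distance_filtration n P (cech n P)"
proof
  fix i j t assume ij: "i < n" "j < n"
  have "norm (P i - P j) \<le> 2 * t" if "norm (P i - q) \<le> t" "norm (P j - q) \<le> t" for q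
    using norm_triangle_ineq4[of "P i - q" "P j - q"] that by simp
  moreover have "\<exists>q. norm (P i - q) \<le> t \<and> norm (P j - q) \<le> t" if "norm (P i - P j) \<le> 2 * t"
    using that dist_midpoint[of "P i" "P j"]
    by (intro exI[of _ "midpoint (P i) (P j)"]) (auto simp: dist_norm norm_minus_commute)
  ultimately show "{i, j} \<in> cech n P t \<longleftrightarrow> norm (P i - P j) \<le> 2 * t"
    using ij by (auto simp: cech_def)
next
  fix s t :: real assume "s \<le> t"
  then show "cech n P s \<subseteq> cech n P t"
    by (auto simp: cech_def intro: order_trans)
qed (use assms in \<open>auto simp: cech_def\<close>)

section \<open>Dimension of the fibers\<close>

theorem theorem2:
  fixes F :: "'k :: field itself"
    and D :: "nat \<Rightarrow> real set multiset"
    and n :: nat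
  assumes "full_barcode D"
    and "n = size (D 0)"
  shows "(\<forall>m. \<forall>P \<in> (cech_fiber F m D \<union> vr_fiber F m D :: (nat \<Rightarrow> real ^ 'd :: finite) set). m = n) \<and>
    cloud_dim n (cech_fiber F n D :: (nat \<Rightarrow> real ^ 'd) set)
      \<le> ereal (real n * real CARD('d) - real n + 1) \<and>
    cloud_dim n (vr_fiber F n D :: (nat \<Rightarrow> real ^ 'd) set)
      \<le> ereal (real n * real CARD('d) - real n + 1)"
proof -
  let ?L = "(\<lambda>I. 2 * Sup I) ` set_mset (D 0)"
  have fiber: "\<exists>X. distance_filtration m P X \<and> persistent_homology_is F X D"
    if "P \<in> cech_fiber F m D \<union> vr_fiber F m D" for m and P :: "nat \<Rightarrow> real ^ 'd"
  proof -
    have inj: "inj_on P {..<m}"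
      using that by (auto simp: cech_fiber_def vr_fiber_def point_clouds_def)
    from that consider "persistent_homology_is F (cech m P) D"
      | "persistent_homology_is F (vietoris_rips m P) D"
      by (auto simp: cech_fiber_def vr_fiber_def)
    then show ?thesis
      using distance_filtration_cech[OF inj] distance_filtration_vietoris_rips[OF inj] by cases blast+
  qed
  have "m = n" if "P \<in> cech_fiber F m D \<union> vr_fiber F m D" for m and P :: "nat \<Rightarrow> real ^ 'd"
    using fiber[OF that] distance_filtration.degree_zero_barcode(1) assms(2) by blast
  moreover have "cloud_dim n S \<le> ereal (real n * real CARD('d) - real n + 1)"
    if S: "S \<subseteq> cech_fiber F n D \<union> vr_fiber F n D" for S :: "(nat \<Rightarrow> real ^ 'd) set"
  proof (rule cloud_dim_le_of_cut_distances)
    show "finite ?L" by simp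
    fix P A assume "P \<in> S" and A: "A \<subseteq> {..<n}" "A \<noteq> {}" "A \<noteq> {..<n}"
    then obtain X where "distance_filtration n P X" "persistent_homology_is F X D"
      using fiber S by blast
    then show "\<exists>i\<in>A. \<exists>j\<in>{..<n} - A. norm (P i - P j) \<in> ?L"
      using A by (rule distance_filtration.degree_zero_barcode(2))
  qed
  ultimately show ?thesis by blast
qed

end
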